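(* Let $A\supset B$ be an irreducible inclusion of separable unital purely infinite simple C$^*$-algebras with a conditional expectation $E:A\to B$ of finite index. Then the inclusion $A\supset B$ has the property (BEK), that is, for all $x,y\in A$, $$\sup_{b\in B,\ \|b\|\le 1}\|xby\|=\|x\|\,\|y\|.$$
   Context: An inclusion of C$^*$-algebras $A\supset B$ is irreducible if $M(A)\cap B'=\mathbb{C}1$, where $M(A)$ is the multiplier algebra of $A$ (so $M(A)=A$ for unital $A$). A conditional expectation $E:A\to B$ has finite index if there is a constant $\lambda\ge 1$ such that $E-\lambda^{-1}\mathrm{id}:A\to A$ is a positive map. *)

theory Defs
  imports "HOL-Analysis.Analysis"
begin

text \<open>
  Unital C*-algebras over the complex numbers. The class \<^class>\<open>real_normed_algebra_1\<close> contributes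
  submultiplicativity of the norm and \<open>norm 1 = 1\<close>, which hold in every nonzero unital C*-algebra;
  \<^class>\<open>banach\<close> contributes completeness.
\<close>

class unital_cstar_algebra = real_normed_algebra_1 + banach +
  fixes scaleC :: "complex \<Rightarrow> 'a \<Rightarrow> 'a" (infixr \<open>*\<^sub>C\<close> 75)
    and star :: "'a \<Rightarrow> 'a"
  assumes scaleC_add_right: "c *\<^sub>C (x + y) = c *\<^sub>C x + c *\<^sub>C y"
    and scaleC_add_left: "(c + d) *\<^sub>C x = c *\<^sub>C x + d *\<^sub>C x"
    and scaleC_scaleC: "c *\<^sub>C d *\<^sub>C x = (c * d) *\<^sub>C x"
    and scaleC_of_real: "complex_of_real r *\<^sub>C x = r *\<^sub>R x"
    and mult_scaleC_left: "(c *\<^sub>C x) * y = c *\<^sub>C (x * y)"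
    and mult_scaleC_right: "x * (c *\<^sub>C y) = c *\<^sub>C (x * y)"
    and norm_scaleC: "norm (c *\<^sub>C x) = cmod c * norm x"
    and star_add: "star (x + y) = star x + star y"
    and star_scaleC: "star (c *\<^sub>C x) = cnj c *\<^sub>C star x"
    and star_mult: "star (x * y) = star y * star x"
    and star_star: "star (star x) = x"
    and cstar_identity: "norm (star x * x) = (norm x)\<^sup>2"

text \<open>
  The notions below are stated for C*-subalgebras of an ambient algebra and only refer to elements
  of the subalgebra, so they are intrinsic to it; the ambient algebra itself is \<^term>\<open>UNIV\<close>.
\<close>

definition cstar_subalgebra :: "'a::unital_cstar_algebra set \<Rightarrow> bool" where
  "cstar_subalgebra B \<longleftrightarrow>
     0 \<in> B \<and> (\<forall>x\<in>B. \<forall>y\<in>B. x + y \<in> B \<and> x * y \<in> B) \<and>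
     (\<forall>c. \<forall>x\<in>B. c *\<^sub>C x \<in> B) \<and> (\<forall>x\<in>B. star x \<in> B) \<and> closed B"

text \<open>The unit of a subalgebra is not required to be the unit of the ambient algebra.\<close>

definition unital_on :: "'a::unital_cstar_algebra set \<Rightarrow> bool" where
  "unital_on B \<longleftrightarrow> (\<exists>e\<in>B. \<forall>b\<in>B. e * b = b \<and> b * e = b)"

definition positive_cone :: "'a::unital_cstar_algebra set \<Rightarrow> 'a set" where
  "positive_cone B = {star x * x | x. x \<in> B}"

definition closed_ideal_in :: "'a::unital_cstar_algebra set \<Rightarrow> 'a set \<Rightarrow> bool" where
  "closed_ideal_in B J \<longleftrightarrow>
     J \<subseteq> B \<and> 0 \<in> J \<and> (\<forall>x\<in>J. \<forall>y\<in>J. x + y \<in> J) \<and> (\<forall>c. \<forall>x\<in>J. c *\<^sub>C x \<in> J) \<and>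
     (\<forall>b\<in>B. \<forall>x\<in>J. b * x \<in> J \<and> x * b \<in> J) \<and> closed J"

definition simple_cstar :: "'a::unital_cstar_algebra set \<Rightarrow> bool" where
  "simple_cstar B \<longleftrightarrow> B \<noteq> {0} \<and> (\<forall>J. closed_ideal_in B J \<longrightarrow> J = {0} \<or> J = B)"

definition hereditary_subalgebra :: "'a::unital_cstar_algebra set \<Rightarrow> 'a set \<Rightarrow> bool" where
  "hereditary_subalgebra B H \<longleftrightarrow>
     cstar_subalgebra H \<and> H \<subseteq> B \<and>
     (\<forall>h\<in>H. \<forall>b\<in>B. b \<in> positive_cone B \<and> h - b \<in> positive_cone B \<longrightarrow> b \<in> H)"

definition is_projection :: "'a::unital_cstar_algebra \<Rightarrow> bool" where
  "is_projection p \<longleftrightarrow> star p = p \<and> p * p = p"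

text \<open>
  A projection is infinite in \<open>B\<close> if it is Murray--von Neumann equivalent, via some \<open>v\<close> in \<open>B\<close>, to a
  proper subprojection of itself (\<open>p * q = q\<close> expresses \<open>q \<le> p\<close> for projections).
\<close>

definition infinite_projection :: "'a::unital_cstar_algebra set \<Rightarrow> 'a \<Rightarrow> bool" where
  "infinite_projection B p \<longleftrightarrow>
     p \<in> B \<and> is_projection p \<and>
     (\<exists>v\<in>B. \<exists>q. star v * v = p \<and> v * star v = q \<and> is_projection q \<and> p * q = q \<and> q \<noteq> p)"

definition purely_infinite :: "'a::unital_cstar_algebra set \<Rightarrow> bool" where
  "purely_infinite B \<longleftrightarrow>
     (\<forall>H. hereditary_subalgebra B H \<and> H \<noteq> {0} \<longrightarrow> (\<exists>p\<in>H. infinite_projection B p))"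

text \<open>For a unital ambient algebra the multiplier algebra is the algebra itself.\<close>

definition relative_commutant :: "'a::unital_cstar_algebra set \<Rightarrow> 'a set" where
  "relative_commutant B = {a. \<forall>b\<in>B. a * b = b * a}"

definition irreducible_inclusion :: "'a::unital_cstar_algebra set \<Rightarrow> bool" where
  "irreducible_inclusion B \<longleftrightarrow> relative_commutant B = range (\<lambda>c. c *\<^sub>C 1)"

text \<open>
  Complete positivity need not be demanded: it follows from positivity and the bimodule property.
\<close>

definition conditional_expectation ::
    "'a::unital_cstar_algebra set \<Rightarrow> ('a \<Rightarrow> 'a) \<Rightarrow> bool" where
  "conditional_expectation B E \<longleftrightarrow>
     (\<forall>x y. E (x + y) = E x + E y) \<and> (\<forall>c x. E (c *\<^sub>C x) = c *\<^sub>C E x) \<and>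
     (\<forall>x. E x \<in> B) \<and> (\<forall>b\<in>B. E b = b) \<and>
     (\<forall>x. \<forall>b\<in>B. E (b * x) = b * E x \<and> E (x * b) = E x * b) \<and>
     (\<forall>x\<in>positive_cone UNIV. E x \<in> positive_cone B) \<and> (\<forall>x. norm (E x) \<le> norm x)"

definition positive_map :: "('a::unital_cstar_algebra \<Rightarrow> 'a) \<Rightarrow> bool" where
  "positive_map f \<longleftrightarrow> (\<forall>x\<in>positive_cone UNIV. f x \<in> positive_cone UNIV)"

definition finite_index :: "('a::unital_cstar_algebra \<Rightarrow> 'a) \<Rightarrow> bool" where
  "finite_index E \<longleftrightarrow> (\<exists>\<kappa>::real. \<kappa> \<ge> 1 \<and> positive_map (\<lambda>x. E x - inverse \<kappa> *\<^sub>R x))"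

text \<open>
  For a subalgebra \<open>B\<close> the set of reals is nonempty (take \<open>b = 0\<close>) and bounded above by
  \<open>norm x * norm y\<close>, so this is a genuine supremum.
\<close>

definition property_BEK :: "'a::unital_cstar_algebra set \<Rightarrow> bool" where
  "property_BEK B \<longleftrightarrow>
     (\<forall>x y. (SUP b\<in>{b \<in> B. norm b \<le> 1}. norm (x * b * y)) = norm x * norm y)"

end

theory Submission
  imports Defs
begin

text \<open>
  The property follows from the existence, below any isometry of \<open>A\<close>, of an isometry \<open>d\<close> with
  \<open>d\<^sup>* E(d a) \<approx> \<tau> a\<close> uniformly for \<open>a\<close> in the unit ball of \<open>A\<close>: given two such \<open>d\<close>, \<open>d'\<close>, the
  element \<open>b = E(d d'\<^sup>*) / \<tau>\<close> has norm about \<open>1\<close> and \<open>d\<^sup>* b d' \<approx> 1\<close>, while pure infiniteness of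
  \<open>A\<close> lets one choose \<open>d\<close> and \<open>d'\<close> so that \<open>x\<^sup>* x d \<approx> \<parallel>x\<parallel>\<^sup>2 d\<close> and \<open>y y\<^sup>* d' \<approx> \<parallel>y\<parallel>\<^sup>2 d'\<close>.

  To find \<open>d\<close>, write \<open>T\<^sub>d(a) = d\<^sup>* E(d a)\<close> and let \<open>d\<close> nearly minimize the norm of the weight
  \<open>d\<^sup>* E(d d\<^sup>*) d\<close> (a square norm of \<open>T\<^sub>d\<close>) under right multiplication by isometries. If \<open>f\<close> and
  \<open>g\<close> are restrictions of \<open>d\<close> with \<open>f\<^sup>* E(g \<cdot>) \<approx> 0 \<approx> g\<^sup>* E(f \<cdot>)\<close>, then the parallelogram identity for
  \<open>(f + g) / \<surd>2\<close> and minimality give \<open>T\<^sub>f \<approx> T\<^sub>g\<close>. Hence \<open>T\<^sub>d\<close> is almost invariant under compression by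
  all isometries and so almost left \<open>A\<close>-linear, \<open>T\<^sub>d(a) \<approx> a T\<^sub>d(1)\<close>; since \<open>T\<^sub>d\<close> is right \<open>B\<close>-linear,
  \<open>T\<^sub>d(1)\<close> almost commutes with \<open>B\<close>, and irreducibility makes it almost scalar.
\<close>

section \<open>Involution and square roots\<close>

lemma star_zero [simp]: "star (0::'a::unital_cstar_algebra) = 0"
  using star_add[of "0::'a" 0] by simp

lemma star_minus [simp]: "star (- x) = - star (x::'a::unital_cstar_algebra)"
proof -
  have "star x + star (- x) = 0" by (simp flip: star_add)
  then show ?thesis by (simp add: eq_neg_iff_add_eq_0 add.commute)
qed

lemma star_diff: "star (x - y) = star x - star (y::'a::unital_cstar_algebra)"
  using star_add[of x "- y"] by simp

lemma star_one [simp]: "star (1::'a::unital_cstar_algebra) = 1"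
proof -
  have "star 1 = star (star (1::'a)) * star 1" by (simp add: star_star)
  also have "\<dots> = star (1 * star (1::'a))" by (rule star_mult[symmetric])
  finally show ?thesis by (simp add: star_star)
qed

lemma star_scaleR: "star (r *\<^sub>R x) = r *\<^sub>R star (x::'a::unital_cstar_algebra)"
  by (metis complex_cnj_complex_of_real scaleC_of_real star_scaleC)

lemma star_sum: "star (sum f S) = (\<Sum>i\<in>S. star (f i :: 'a::unital_cstar_algebra))"
  by (induction S rule: infinite_finite_induct) (simp_all add: star_add)

lemma star_power: "star (x ^ n) = star (x::'a::unital_cstar_algebra) ^ n"
  by (induction n) (simp_all add: star_mult power_commutes)

lemma norm_star [simp]: "norm (star (x::'a::unital_cstar_algebra)) = norm x"
proof -
  have le: "norm y \<le> norm (star y)" for y :: 'a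
  proof (cases "y = 0")
    case False
    have "(norm y)\<^sup>2 \<le> norm (star y) * norm y"
      using norm_mult_ineq[of "star y" y] by (simp add: cstar_identity)
    then show ?thesis using False by (simp add: power2_eq_square)
  qed simp
  from le[of x] le[of "star x"] show ?thesis by (simp add: star_star)
qed

lemma cstar_identity': "norm (x * star x) = (norm (x::'a::unital_cstar_algebra))\<^sup>2"
  using cstar_identity[of "star x"] by (simp add: star_star)

lemma bounded_linear_star: "bounded_linear (star :: 'a::unital_cstar_algebra \<Rightarrow> 'a)"
  by (rule bounded_linear_intro[of _ 1]) (simp_all add: star_add star_scaleR)

section \<open>The binomial series of \<open>sqrt (1 - x)\<close>\<close>

definition sqrt_coeff :: "nat \<Rightarrow> real" where
  "sqrt_coeff n = ((1/2) gchoose n) * (-1) ^ n"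

text \<open>Kept general in \<open>a\<close>: the value 1/2 gives the signs of the coefficients, and
  -1/2 the signs of their partial sums.\<close>

lemma signed_gbinomial_rec:
  "of_nat (Suc n) * ((a gchoose (Suc n)) * (-1) ^ Suc n) = (of_nat n - a) * ((a gchoose n) * (-1) ^ n)"
  for a :: real
proof -
  have rec: "of_nat (Suc n) * (a gchoose (Suc n)) = (a - of_nat n) * (a gchoose n)"
    using gbinomial_mult_1[of a n] by (simp add: algebra_simps)
  have "of_nat (Suc n) * ((a gchoose (Suc n)) * (-1) ^ Suc n) =
      (of_nat (Suc n) * (a gchoose (Suc n))) * (-1) ^ Suc n"
    by (simp only: mult.assoc)
  also have "\<dots> = (of_nat n - a) * ((a gchoose n) * (-1) ^ n)"
    unfolding rec by (simp add: algebra_simps)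
  finally show ?thesis .
qed

lemmas sqrt_coeff_rec = signed_gbinomial_rec[of _ "1/2", folded sqrt_coeff_def]

lemma sqrt_coeff_nonpos: "sqrt_coeff (Suc n) \<le> 0"
proof (induction n)
  case 0
  then show ?case by (simp add: sqrt_coeff_def)
next
  case (Suc n)
  have "(of_nat (Suc n) - 1/2) * sqrt_coeff (Suc n) \<le> 0"
    using Suc by (intro mult_nonneg_nonpos) auto
  then have "of_nat (Suc (Suc n)) * sqrt_coeff (Suc (Suc n)) \<le> 0"
    by (simp only: sqrt_coeff_rec)
  then show ?case by (simp add: mult_le_0_iff del: of_nat_Suc)
qed

text \<open>The partial sums of the signed binomial coefficients of 1/2 are those of -1/2 and hence
  nonnegative. Since the zeroth coefficient is 1 and the others are at most 0, the absolute values
  of the latter add up to at most 1.\<close>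

lemma sqrt_coeff_partial_sum: "(\<Sum>k<n. \<bar>sqrt_coeff (Suc k)\<bar>) \<le> 1"
proof -
  have pos: "0 \<le> ((-1/2::real) gchoose n) * (-1) ^ n"
  proof (induction n)
    case (Suc n)
    have "0 \<le> (of_nat n - (-1/2)) * (((-1/2::real) gchoose n) * (-1) ^ n)"
      by (rule mult_nonneg_nonneg[OF _ Suc]) simp
    then have "0 \<le> of_nat (Suc n) * (((-1/2::real) gchoose Suc n) * (-1) ^ Suc n)"
      by (simp only: signed_gbinomial_rec)
    then show ?case
      using mult_left_le_imp_le[of "of_nat (Suc n)" 0 "((-1/2::real) gchoose Suc n) * (-1) ^ Suc n"]
      by simp
  qed simp
  have "(\<Sum>k\<le>n. sqrt_coeff k) = (-1) ^ n * ((1/2 - 1::real) gchoose n)"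
    unfolding sqrt_coeff_def by (rule gbinomial_sum_lower_neg)
  also have "\<dots> \<ge> 0" using pos by (simp add: mult.commute)
  finally have "0 \<le> (\<Sum>k<Suc n. sqrt_coeff k)" by (simp add: lessThan_Suc_atMost)
  then have "0 \<le> 1 + (\<Sum>k<n. sqrt_coeff (Suc k))"
    unfolding sum.lessThan_Suc_shift by (simp add: sqrt_coeff_def)
  moreover have "\<bar>sqrt_coeff (Suc k)\<bar> = - sqrt_coeff (Suc k)" for k
    using sqrt_coeff_nonpos[of k] by simp
  ultimately show ?thesis by (simp add: sum_negf)
qed

lemma sqrt_coeff_summable: "summable (\<lambda>k. \<bar>sqrt_coeff (Suc k)\<bar>)"
  using sqrt_coeff_partial_sum by (intro summableI_nonneg_bounded[where x = 1]) auto

lemma sqrt_coeff_suminf: "(\<Sum>k. \<bar>sqrt_coeff (Suc k)\<bar>) \<le> 1"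
  using sqrt_coeff_summable sqrt_coeff_partial_sum by (intro suminf_le_const)

lemma sqrt_coeff_convolution:
  "(\<Sum>i\<le>k. sqrt_coeff i * sqrt_coeff (k - i)) = (if k = 0 then 1 else if k = 1 then -1 else 0)"
proof -
  have "(\<Sum>i\<le>k. sqrt_coeff i * sqrt_coeff (k - i)) =
      (-1) ^ k * (\<Sum>i=0..k. ((1/2) gchoose i) * ((1/2) gchoose (k - i)))"
    unfolding sqrt_coeff_def sum_distrib_left atMost_atLeast0
    by (intro sum.cong refl) (auto simp: algebra_simps simp flip: power_add)
  also have "\<dots> = (-1) ^ k * ((1/2 + 1/2 :: real) gchoose k)"
    by (subst gbinomial_Vandermonde) simp
  also have "\<dots> = (-1) ^ k * real (1 choose k)"
    using binomial_gbinomial[of 1 k, where 'a = real] by simp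
  also have "\<dots> = (if k = 0 then 1 else if k = 1 then -1 else 0)"
    by (cases k) (auto simp: binomial_eq_0)
  finally show ?thesis .
qed

text \<open>The series converges absolutely on the closed unit ball, and its Cauchy square is
  \<open>1 - x\<close>. The bound on \<open>1 - y\<close> puts the root itself in a ball around a
  scalar, which later certifies its positivity; commutation passes from powers of \<open>x\<close>
  to the limit.\<close>

lemma sqrt_one_minus:
  fixes x :: "'a::unital_cstar_algebra"
  assumes nx: "norm x \<le> 1" and sx: "star x = x"
  obtains y where "y * y = 1 - x" "star y = y" "norm (1 - y) \<le> 1"
    "\<And>z. z * x = x * z \<Longrightarrow> z * y = y * z"
proof -
  define f where "f n = sqrt_coeff n *\<^sub>R x ^ n" for n
  have nf: "norm (f n) \<le> \<bar>sqrt_coeff n\<bar>" for n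
    unfolding f_def using norm_power_ineq[of x n] power_le_one[OF norm_ge_zero nx, of n]
    by (simp add: mult_left_le)
  have sm0: "summable (\<lambda>n. \<bar>sqrt_coeff n\<bar>)"
    using sqrt_coeff_summable by (subst (asm) summable_Suc_iff)
  have smn: "summable (\<lambda>n. norm (f n))"
    by (rule summable_comparison_test'[OF sm0, of 0]) (simp add: nf)
  then have sm: "summable f" by (rule summable_norm_cancel)
  define y where "y = suminf f"
  have "y * y = (\<Sum>k. \<Sum>i\<le>k. f i * f (k - i))"
    unfolding y_def by (rule Cauchy_product[OF smn smn])
  also have "\<dots> = (\<Sum>k. (if k = 0 then 1 else if k = 1 then -1 else 0) *\<^sub>R x ^ k)"
  proof (rule suminf_cong)
    fix k
    have "(\<Sum>i\<le>k. f i * f (k - i)) = (\<Sum>i\<le>k. sqrt_coeff i * sqrt_coeff (k - i)) *\<^sub>R x ^ k"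
      unfolding f_def scaleR_sum_left
      by (intro sum.cong refl) (simp flip: power_add)
    then show "(\<Sum>i\<le>k. f i * f (k - i)) = (if k = 0 then 1 else if k = 1 then -1 else 0) *\<^sub>R x ^ k"
      by (simp only: sqrt_coeff_convolution)
  qed
  also have "\<dots> = (\<Sum>k\<in>{0,1}. (if k = 0 then 1 else if k = 1 then -1 else 0) *\<^sub>R x ^ k)"
    by (rule suminf_finite) auto
  also have "\<dots> = 1 - x" by simp
  finally have yy: "y * y = 1 - x" .
  have "star y = (\<Sum>n. star (f n))"
    unfolding y_def by (rule bounded_linear.suminf[OF bounded_linear_star sm])
  then have sy: "star y = y" by (simp add: f_def[abs_def] y_def star_scaleR star_power sx)
  have "y = f 0 + (\<Sum>n. f (Suc n))" unfolding y_def using suminf_split_head[OF sm] by simp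
  then have "1 - y = - (\<Sum>n. f (Suc n))" by (simp add: f_def sqrt_coeff_def)
  then have "norm (1 - y) = norm (\<Sum>n. f (Suc n))" by simp
  also have "\<dots> \<le> (\<Sum>n. norm (f (Suc n)))"
    using summable_Suc_iff[of "\<lambda>n. norm (f n)"] smn by (intro summable_norm) simp
  also have "\<dots> \<le> (\<Sum>n. \<bar>sqrt_coeff (Suc n)\<bar>)"
    using summable_Suc_iff[of "\<lambda>n. norm (f n)"] smn by (intro suminf_le sqrt_coeff_summable nf) simp
  also have "\<dots> \<le> 1" by (rule sqrt_coeff_suminf)
  finally have ny: "norm (1 - y) \<le> 1" .
  have comm: "z * y = y * z" if "z * x = x * z" for z
  proof -
    have "z * x ^ n = x ^ n * z" for n
      by (induction n) (simp_all add: that mult.assoc, metis mult.assoc that)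
    then have "z * f n = f n * z" for n by (simp add: f_def)
    then show ?thesis unfolding y_def
      by (simp add: suminf_mult[OF sm, symmetric] suminf_mult2[OF sm])
  qed
  show thesis using that yy sy ny comm by blast
qed

section \<open>The positive cone\<close>

text \<open>Squares of self-adjoint elements are used instead of all \<open>star x * x\<close>,
  since sums and roots can be treated for them first. That both describe the same cone is
  \<open>positive_cone_UNIV\<close>.\<close>

definition psd :: "'a::unital_cstar_algebra \<Rightarrow> bool" where
  "psd a \<longleftrightarrow> (\<exists>h. star h = h \<and> a = h * h)"

lemma psd_selfadj: "psd a \<Longrightarrow> star a = a"
  by (auto simp: psd_def star_mult)

section \<open>Complex scalars and products in cartesian form\<close>

lemma iscale_mult: "(\<i> *\<^sub>C x) * (\<i> *\<^sub>C y) = - (x * (y::'a::unital_cstar_algebra))"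
proof -
  have "(\<i> *\<^sub>C x) * (\<i> *\<^sub>C y) = complex_of_real (-1) *\<^sub>C (x * y)"
    by (simp add: mult_scaleC_left mult_scaleC_right scaleC_scaleC)
  then show ?thesis by (simp only: scaleC_of_real) simp
qed

lemma scaleC_minus_left: "(- c) *\<^sub>C x = - (c *\<^sub>C (x::'a::unital_cstar_algebra))"
proof -
  have "(- c) *\<^sub>C x = (complex_of_real (-1) * c) *\<^sub>C x" by simp
  also have "\<dots> = complex_of_real (-1) *\<^sub>C (c *\<^sub>C x)" by (simp only: scaleC_scaleC)
  finally show ?thesis by (simp only: scaleC_of_real) simp
qed

lemma scaleC_minus_right: "c *\<^sub>C (- x) = - (c *\<^sub>C (x::'a::unital_cstar_algebra))"
proof -
  have "c *\<^sub>C (- x) = c *\<^sub>C (complex_of_real (-1) *\<^sub>C x)" by (simp only: scaleC_of_real) simp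
  also have "\<dots> = (- c) *\<^sub>C x" by (simp add: scaleC_scaleC)
  finally show ?thesis by (simp add: scaleC_minus_left)
qed

lemma scaleC_diff_right: "c *\<^sub>C (x - y) = c *\<^sub>C x - c *\<^sub>C (y::'a::unital_cstar_algebra)"
  using scaleC_add_right[of c x "- y"] by (simp add: scaleC_minus_right)

lemma scaleC_one [simp]: "1 *\<^sub>C x = (x::'a::unital_cstar_algebra)"
  using scaleC_of_real[of 1 x] by simp

lemma scaleC_zero_right [simp]: "c *\<^sub>C (0::'a::unital_cstar_algebra) = 0"
  using scaleC_diff_right[of c 0 0] by simp

lemma star_iscale: "star (\<i> *\<^sub>C x) = - (\<i> *\<^sub>C star (x::'a::unital_cstar_algebra))"
  by (simp add: star_scaleC scaleC_minus_left)

lemma cartesian_mult: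
  fixes h k :: "'a::unital_cstar_algebra"
  shows "(h - \<i> *\<^sub>C k) * (h + \<i> *\<^sub>C k) = h * h + k * k + \<i> *\<^sub>C (h * k - k * h)"
    and "(h + \<i> *\<^sub>C k) * (h - \<i> *\<^sub>C k) = h * h + k * k - \<i> *\<^sub>C (h * k - k * h)"
  by (simp_all only: ring_distribs iscale_mult)
    (simp_all add: mult_scaleC_left mult_scaleC_right scaleC_diff_right)

text \<open>For a root \<open>k\<close> of \<open>1 - h * h\<close> commuting with \<open>h\<close>,
  the element \<open>h + \<i> *\<^sub>C k\<close> has norm 1, and \<open>k\<close> is its imaginary
  part. This bounds \<open>1 - h * h\<close> by 1 without spectral theory.\<close>

lemma square_in_unit_ball:
  fixes h :: "'a::unital_cstar_algebra"
  assumes sh: "star h = h" and nh: "norm h \<le> 1"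
  obtains k where "star k = k" "k * k = 1 - h * h" "norm k \<le> 1" "h * k = k * h"
proof -
  have "norm (h * h) \<le> 1"
    using norm_mult_ineq[of h h] mult_le_one[OF nh norm_ge_zero nh] by linarith
  moreover have "star (h * h) = h * h" by (simp add: star_mult sh)
  ultimately obtain k where kk: "k * k = 1 - h * h" and sk: "star k = k"
    and com: "\<And>z. z * (h * h) = (h * h) * z \<Longrightarrow> z * k = k * z"
    by (rule sqrt_one_minus) blast
  have hk: "h * k = k * h" using com[of h] by (simp add: mult.assoc)
  define u where "u = h + \<i> *\<^sub>C k"
  have su: "star u = h - \<i> *\<^sub>C k" by (simp add: u_def star_add star_iscale sh sk)
  have "star u * u = h * h + k * k"
    unfolding su unfolding u_def cartesian_mult using hk by (simp add: scaleC_diff_right)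
  then have "(norm u)\<^sup>2 = 1" by (simp add: kk flip: cstar_identity)
  then have nu: "norm u = 1" by (simp add: power2_eq_1_iff) (smt (verit) norm_ge_zero)
  have "u - star u = 2 *\<^sub>R (\<i> *\<^sub>C k)" unfolding su by (simp add: u_def scaleR_2)
  then have "norm (2 *\<^sub>R (\<i> *\<^sub>C k)) \<le> 1 + 1"
    using norm_triangle_ineq4[of u "star u"] by (simp add: nu)
  then have "norm k \<le> 1" by (simp add: norm_scaleC)
  with that sk kk hk show thesis by blast
qed

lemma unitary_mean:
  fixes h :: "'a::unital_cstar_algebra"
  assumes "star h = h" "norm h \<le> 1"
  obtains u where "star u * u = 1" "u * star u = 1" "2 *\<^sub>R h = u + star u"
proof -
  obtain k where k: "star k = k" "k * k = 1 - h * h" "norm k \<le> 1" "h * k = k * h"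
    by (rule square_in_unit_ball[OF assms])
  define u where "u = h + \<i> *\<^sub>C k"
  have su: "star u = h - \<i> *\<^sub>C k" by (simp add: u_def star_add star_iscale assms k)
  have "star u * u = 1" "u * star u = 1"
    unfolding su unfolding u_def cartesian_mult using k by simp_all
  moreover have "2 *\<^sub>R h = u + star u" unfolding su by (simp add: u_def scaleR_2)
  ultimately show thesis by (rule that)
qed

lemma square_in_ball:
  fixes h :: "'a::unital_cstar_algebra"
  assumes sh: "star h = h" and nh: "(norm h)\<^sup>2 \<le> t"
  shows "norm (t *\<^sub>R 1 - h * h) \<le> t"
proof (cases "t = 0")
  case True
  then show ?thesis using nh by simp
next
  case False
  then have t: "t > 0" using nh by (smt (verit) zero_le_power2)
  define g where "g = (1 / sqrt t) *\<^sub>R h"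
  have "star g = g" by (simp add: g_def star_scaleR sh)
  moreover have "norm g \<le> 1" using t nh real_le_rsqrt[OF nh] by (simp add: g_def divide_simps)
  ultimately obtain k where k: "star k = k" "k * k = 1 - g * g" "norm k \<le> 1"
    by (rule square_in_unit_ball)
  have "t *\<^sub>R 1 - h * h = t *\<^sub>R (k * k)"
    using t unfolding k(2) by (simp add: g_def algebra_simps divide_simps)
  then have "norm (t *\<^sub>R 1 - h * h) = t * norm (k * k)" using t by simp
  also have "\<dots> \<le> t * 1"
    using t k(3) norm_mult_ineq[of k k] mult_le_one[OF k(3) norm_ge_zero k(3)]
    by (intro mult_left_mono) auto
  finally show ?thesis by simp
qed

text \<open>Rescaling by \<open>t\<close> reduces to the root of \<open>1 - x\<close> with
  \<open>norm x \<le> 1\<close>. The root again lies in a ball of the same kind, so it is positive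
  too.\<close>

lemma root_of_ball:
  fixes a :: "'a::unital_cstar_algebra"
  assumes sa: "star a = a" and na: "norm (t *\<^sub>R 1 - a) \<le> t"
  obtains h s where "star h = h" "h * h = a" "norm (s *\<^sub>R 1 - h) \<le> s"
    "\<And>z. z * a = a * z \<Longrightarrow> z * h = h * z"
proof (cases "t = 0")
  case True
  then show ?thesis using na that[of 0 0] by simp
next
  case False
  then have t: "t > 0" using na by (smt (verit) norm_ge_zero)
  define x where "x = 1 - (1/t) *\<^sub>R a"
  have "x = (1/t) *\<^sub>R (t *\<^sub>R 1 - a)" using t by (simp add: x_def algebra_simps)
  then have "norm x = norm (t *\<^sub>R 1 - a) / t" using t by simp
  then have "norm x \<le> 1" using t na by simp
  moreover have "star x = x" by (simp add: x_def star_diff star_scaleR sa)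
  ultimately obtain y where y: "y * y = 1 - x" "star y = y" "norm (1 - y) \<le> 1"
    and com: "\<And>z. z * x = x * z \<Longrightarrow> z * y = y * z"
    by (rule sqrt_one_minus) blast
  show thesis
  proof (rule that)
    show "star (sqrt t *\<^sub>R y) = sqrt t *\<^sub>R y" by (simp add: star_scaleR y)
    show "(sqrt t *\<^sub>R y) * (sqrt t *\<^sub>R y) = a" using t by (simp add: y x_def)
    have "sqrt t *\<^sub>R 1 - sqrt t *\<^sub>R y = sqrt t *\<^sub>R (1 - y)" by (simp add: algebra_simps)
    then show "norm (sqrt t *\<^sub>R 1 - sqrt t *\<^sub>R y) \<le> sqrt t" 
      using t y(3) by (simp add: mult_left_le)
    fix z assume "z * a = a * z"
    then have "z * x = x * z" by (simp add: x_def algebra_simps)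
    then show "z * (sqrt t *\<^sub>R y) = sqrt t *\<^sub>R y * z" using com by simp
  qed
qed

text \<open>This criterion makes the cone additive: the balls of radii \<open>s\<close> and
  \<open>t\<close> around \<open>s\<close> and \<open>t\<close> add up to one of radius
  \<open>s + t\<close> around \<open>s + t\<close>.\<close>

lemma psd_iff_ball: "psd a \<longleftrightarrow> star a = a \<and> (\<exists>t. norm (t *\<^sub>R 1 - a) \<le> t)"
proof
  assume "psd a"
  then obtain h where h: "star h = h" "a = h * h" by (auto simp: psd_def)
  then show "star a = a \<and> (\<exists>t. norm (t *\<^sub>R 1 - a) \<le> t)"
    using square_in_ball[OF h(1) order_refl] by (auto simp: star_mult)
next
  assume "star a = a \<and> (\<exists>t. norm (t *\<^sub>R 1 - a) \<le> t)"
  then obtain t where "star a = a" "norm (t *\<^sub>R 1 - a) \<le> t" by blast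
  then obtain h where "star h = h" "h * h = a" by (rule root_of_ball)
  then show "psd a" by (auto simp: psd_def)
qed

lemma psd_iff_norm: "psd a \<longleftrightarrow> star a = a \<and> norm (norm a *\<^sub>R 1 - a) \<le> norm a"
proof
  assume "psd a"
  then obtain h where h: "star h = h" "a = h * h" by (auto simp: psd_def)
  then have "(norm h)\<^sup>2 = norm a" using cstar_identity[of h] by simp
  then show "star a = a \<and> norm (norm a *\<^sub>R 1 - a) \<le> norm a"
    using h square_in_ball[of h "norm a"] by (simp add: star_mult)
qed (auto simp: psd_iff_ball)

lemma psd_root:
  assumes "psd a"
  obtains h where "psd h" "h * h = a" "\<And>z. z * a = a * z \<Longrightarrow> z * h = h * z"
proof -
  from assms have "star a = a" "norm (norm a *\<^sub>R 1 - a) \<le> norm a" by (simp_all add: psd_iff_norm)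
  then obtain h s where h: "star h = h" "norm (s *\<^sub>R 1 - h) \<le> s" "h * h = a"
    and com: "\<And>z. z * a = a * z \<Longrightarrow> z * h = h * z"
    by (rule root_of_ball) blast
  have "psd h" using h by (auto simp: psd_iff_ball)
  then show thesis using h(3) com by (rule that)
qed

lemma psd_square: "star h = h \<Longrightarrow> psd (h * h)"
  by (auto simp: psd_def)

lemma psd_add: "psd a \<Longrightarrow> psd b \<Longrightarrow> psd (a + b)"
proof -
  assume "psd a" "psd b"
  then obtain s t where "star a = a" "star b = b" "norm (s *\<^sub>R 1 - a) \<le> s" "norm (t *\<^sub>R 1 - b) \<le> t"
    by (auto simp: psd_iff_ball)
  moreover have "(s + t) *\<^sub>R 1 - (a + b) = (s *\<^sub>R 1 - a) + (t *\<^sub>R 1 - b)" by (simp add: algebra_simps)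
  ultimately have "norm ((s + t) *\<^sub>R 1 - (a + b)) \<le> s + t"
    by (simp only:) (rule norm_triangle_le, rule add_mono)
  then show ?thesis
    using \<open>star a = a\<close> \<open>star b = b\<close> by (auto simp: psd_iff_ball star_add)
qed

lemma psd_scaleR: "psd a \<Longrightarrow> 0 \<le> r \<Longrightarrow> psd (r *\<^sub>R a)"
  unfolding psd_def by clarify (rule_tac x = "sqrt r *\<^sub>R h" in exI, simp add: star_scaleR)

lemma psd_zero [simp]: "psd 0"
  using psd_square[of 0] by simp

lemma psd_sum: "(\<And>i. i \<in> S \<Longrightarrow> psd (f i)) \<Longrightarrow> psd (sum f S)"
  by (induction S rule: infinite_finite_induct) (simp_all add: psd_add)

lemma psd_real: "0 \<le> r \<Longrightarrow> psd (r *\<^sub>R 1)"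
  using psd_scaleR[of 1 r] psd_square[of 1] by simp

lemma psd_trans: "psd (b - a) \<Longrightarrow> psd (c - b) \<Longrightarrow> psd (c - a)"
  using psd_add[of "b - a" "c - b"] by simp

lemma psd_norm_minus:
  assumes "star a = a" "norm a \<le> t"
  shows "psd (t *\<^sub>R 1 - a)"
  unfolding psd_iff_ball using assms by (auto simp: star_diff star_scaleR intro!: exI[of _ t])

lemma psd_norm_plus: "star a = a \<Longrightarrow> norm a \<le> t \<Longrightarrow> psd (t *\<^sub>R 1 + a)"
  using psd_norm_minus[of "- a" t] by simp

section \<open>Order, norm and absolute value\<close>

lemma sum_squares_eq_zero:
  fixes h k :: "'a::unital_cstar_algebra"
  assumes "star h = h" "star k = k" "h * k = k * h" "h * h + k * k = 0"
  shows "h = 0"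
proof -
  define u where "u = h + \<i> *\<^sub>C k"
  have su: "star u = h - \<i> *\<^sub>C k" by (simp add: u_def star_add star_iscale assms)
  have "star u * u = h * h + k * k"
    unfolding su unfolding u_def cartesian_mult using assms by (simp add: scaleC_diff_right)
  then have "(norm u)\<^sup>2 = 0" using assms by (simp flip: cstar_identity)
  then have "u = 0" by simp
  then have "u + star u = 0" by simp
  then have "2 *\<^sub>R h = 0" unfolding su by (simp add: u_def scaleR_2)
  then show ?thesis by simp
qed

text \<open>Roots of \<open>a\<close> and \<open>- a\<close> can be chosen to commute, and their
  squares add up to 0.\<close>

lemma psd_antisym:
  assumes "psd a" "psd (- a)"
  shows "a = 0"
proof -
  from assms(1) obtain h where h: "psd h" "h * h = a" "\<And>z. z * a = a * z \<Longrightarrow> z * h = h * z"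
    by (rule psd_root) blast
  from assms(2) obtain k where k: "psd k" "k * k = - a"
      "\<And>z. z * (- a) = (- a) * z \<Longrightarrow> z * k = k * z"
    by (rule psd_root) blast
  have "h * a = a * h" by (simp add: mult.assoc flip: h(2))
  then have "h * k = k * h" using k(3)[of h] by simp
  then have "h = 0"
    using sum_squares_eq_zero[of h k] h(1,2) k(1,2) by (simp add: psd_selfadj)
  then show ?thesis using h(2) by simp
qed

text \<open>Commuting roots \<open>h\<close> of \<open>a\<close> and \<open>k\<close> of
  \<open>t *\<^sub>R 1 - a\<close> give \<open>u = h + \<i> *\<^sub>C k\<close> with
  \<open>star u * u = t *\<^sub>R 1\<close>; the real part \<open>h\<close> of \<open>u\<close> is
  no larger than \<open>u\<close>.\<close>

lemma norm_le_of_psd: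
  fixes a :: "'a::unital_cstar_algebra"
  assumes a: "psd a" and ta: "psd (t *\<^sub>R 1 - a)"
  shows "norm a \<le> t"
proof -
  from a obtain h where h: "psd h" "h * h = a" "\<And>z. z * a = a * z \<Longrightarrow> z * h = h * z"
    by (rule psd_root) blast
  from ta obtain k where k: "psd k" "k * k = t *\<^sub>R 1 - a"
      "\<And>z. z * (t *\<^sub>R 1 - a) = (t *\<^sub>R 1 - a) * z \<Longrightarrow> z * k = k * z"
    by (rule psd_root) blast
  have "h * a = a * h" by (simp add: mult.assoc flip: h(2))
  then have hk: "h * k = k * h" using k(3)[of h] by (simp add: algebra_simps)
  define u where "u = h + \<i> *\<^sub>C k"
  have su: "star u = h - \<i> *\<^sub>C k" using h(1) k(1) by (simp add: u_def star_add star_iscale psd_selfadj)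
  have "star u * u = h * h + k * k"
    unfolding su unfolding u_def cartesian_mult using hk by (simp add: scaleC_diff_right)
  also have "\<dots> = t *\<^sub>R 1" using h(2) k(2) by simp
  finally have nu: "(norm u)\<^sup>2 = \<bar>t\<bar>" by (simp flip: cstar_identity)
  have "2 *\<^sub>R h = u + star u" unfolding su by (simp add: u_def scaleR_2)
  then have "2 * norm h \<le> norm u + norm u"
    using norm_triangle_ineq[of u "star u"] by (metis norm_scaleR norm_star abs_numeral)
  then have "norm h \<le> norm u" by simp
  moreover have "norm a = (norm h)\<^sup>2"
    using cstar_identity[of h] h(1,2) by (simp add: psd_selfadj)
  ultimately have "norm a \<le> \<bar>t\<bar>" using nu by (metis norm_ge_zero power_mono)
  \<comment> \<open>The norm of \<open>u\<close> only sees the absolute value of \<open>t\<close>,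
    so a negative \<open>t\<close> is excluded separately.\<close>
  moreover have "0 \<le> t"
  proof (rule ccontr)
    assume "\<not> 0 \<le> t"
    have "psd (t *\<^sub>R (1::'a))" using psd_add[OF a ta] by simp
    moreover have "psd (- (t *\<^sub>R 1 :: 'a))" using psd_real[of "- t"] \<open>\<not> 0 \<le> t\<close> by simp
    ultimately have "t *\<^sub>R (1::'a) = 0" by (rule psd_antisym)
    then show False using \<open>\<not> 0 \<le> t\<close> by simp
  qed
  ultimately show ?thesis by simp
qed

lemma psd_real_iff [simp]: "psd (t *\<^sub>R (1::'a::unital_cstar_algebra)) \<longleftrightarrow> 0 \<le> t"
  using norm_le_of_psd[of "0::'a" t] psd_real by auto

lemma norm_mono_psd: "psd a \<Longrightarrow> psd (b - a) \<Longrightarrow> norm a \<le> norm b"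
proof -
  assume "psd a" "psd (b - a)"
  then have "psd b" using psd_add[of a "b - a"] by simp
  then have "psd (norm b *\<^sub>R 1 - b)" by (intro psd_norm_minus) (simp_all add: psd_selfadj)
  then show ?thesis using \<open>psd a\<close> \<open>psd (b - a)\<close> psd_trans norm_le_of_psd by blast
qed

lemma abs_exists:
  fixes a :: "'a::unital_cstar_algebra"
  assumes "star a = a"
  obtains s where "psd s" "s * s = a * a" "\<And>z. z * a = a * z \<Longrightarrow> z * s = s * z"
proof -
  from psd_square[OF assms] obtain s where s: "psd s" "s * s = a * a"
      "\<And>z. z * (a * a) = a * a * z \<Longrightarrow> z * s = s * z"
    by (rule psd_root) blast
  have "z * (a * a) = a * a * z" if "z * a = a * z" for z
    using that by (metis mult.assoc)
  then show thesis using s that by blast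
qed

lemma selfadj_square_zero: "star x = x \<Longrightarrow> x * x = 0 \<Longrightarrow> x = (0::'a::unital_cstar_algebra)"
  using cstar_identity[of x] by simp

lemma cartesian_decomposition:
  fixes x :: "'a::unital_cstar_algebra"
  obtains h k where "star h = h" "star k = k" "x = h + \<i> *\<^sub>C k" "norm h \<le> norm x" "norm k \<le> norm x"
proof (rule that)
  define h where "h = (1/2) *\<^sub>R (x + star x)"
  define k where "k = (1/2) *\<^sub>R (\<i> *\<^sub>C (star x - x))"
  show "star h = h" by (simp add: h_def star_scaleR star_add star_star add.commute)
  show "star k = k"
    by (simp add: k_def star_scaleR star_iscale star_diff star_star scaleC_diff_right)
  have "\<i> *\<^sub>C k = (1/2) *\<^sub>R (\<i> *\<^sub>C \<i> *\<^sub>C (star x - x))"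
    unfolding k_def by (simp only: scaleC_of_real[symmetric] scaleC_scaleC ac_simps)
  also have "\<dots> = (1/2) *\<^sub>R (x - star x)"
    by (simp add: scaleC_scaleC scaleC_minus_left)
  finally show "x = h + \<i> *\<^sub>C k"
    unfolding h_def by (simp flip: scaleR_add_right scaleR_2)
  show "norm h \<le> norm x" using norm_triangle_ineq[of x "star x"] by (simp add: h_def)
  show "norm k \<le> norm x"
    using norm_triangle_ineq4[of "star x" x] by (simp add: k_def norm_scaleC)
qed

text \<open>
  With \<open>a = x\<^sup>* x\<close>, \<open>s = |a|\<close> and \<open>m = s - a\<close>, the element \<open>y = x m\<close> satisfies
  \<open>y\<^sup>* y = - s m\<^sup>2\<close>. If both \<open>- y\<^sup>* y\<close> and \<open>- y y\<^sup>*\<close> were positive, then \<open>y = 0\<close>, because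
  \<open>y\<^sup>* y + y y\<^sup>*\<close> is a sum of squares; otherwise one passes from \<open>y\<close> to \<open>y k\<close> with \<open>k\<^sup>2 = - y\<^sup>* y\<close>.
\<close>

lemma star_mult_sum_psd: "psd (star y * y + y * star (y::'a::unital_cstar_algebra))"
proof -
  obtain h k where hk: "star h = h" "star k = k" "y = h + \<i> *\<^sub>C k"
    by (rule cartesian_decomposition)
  then have sy: "star y = h - \<i> *\<^sub>C k" by (simp add: star_add star_iscale)
  have "star y * y + y * star y = 2 *\<^sub>R (h * h + k * k)"
    unfolding sy unfolding hk(3) cartesian_mult by (simp add: scaleR_2)
  then show ?thesis using hk by (simp add: psd_scaleR psd_add psd_square)
qed

lemma zero_if_negatives_psd:
  assumes "psd (- (star y * y))" "psd (- (y * star y))"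
  shows "y = 0"
proof -
  have "psd (- (star y * y + y * star y))" using psd_add[OF assms] by simp
  then have "star y * y + y * star y = 0"
    using star_mult_sum_psd[of y] psd_antisym by blast
  then have "- (star y * y) = y * star y" by (simp only: neg_eq_iff_add_eq_0)
  then have "y * star y = 0" using psd_antisym[of "y * star y"] assms by simp
  then show ?thesis using cstar_identity'[of y] by simp
qed

lemma zero_if_negative_psd:
  fixes y :: "'a::unital_cstar_algebra"
  assumes neg: "psd (- (star y * y))"
  shows "y = 0"
proof -
  from neg obtain k where k: "psd k" "k * k = - (star y * y)" by (rule psd_root)
  have sk: "star k = k" using k by (simp add: psd_selfadj)
  define d where "d = y * star y"
  have sd: "star d = d" by (simp add: d_def star_mult star_star)
  define y' where "y' = y * k"
  have yy: "star y * y = - (k * k)" using k by simp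
  have "star y' * y' = k * (star y * y) * k" by (simp add: y'_def star_mult sk mult.assoc)
  then have "- (star y' * y') = (k * k) * (k * k)" unfolding yy by (simp add: mult.assoc)
  moreover have "star (k * k) = k * k" by (simp add: star_mult sk)
  ultimately have 1: "psd (- (star y' * y'))" using psd_square by metis
  have "d * d = y * (star y * y) * star y" by (simp add: d_def mult.assoc)
  then have "- (y' * star y') = d * d"
    unfolding yy by (simp add: y'_def star_mult sk mult.assoc)
  then have 2: "psd (- (y' * star y'))" using psd_square[OF sd] by simp
  have "y' = 0" using 1 2 by (rule zero_if_negatives_psd)
  then have "d * d = 0" using \<open>- (y' * star y') = d * d\<close> by simp
  then have "d = 0" using selfadj_square_zero sd by blast
  then show ?thesis using cstar_identity'[of y] by (simp add: d_def)
qed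

lemma psd_star_mult: "psd (star x * (x::'a::unital_cstar_algebra))"
proof -
  define a where "a = star x * x"
  have sa: "star a = a" by (simp add: a_def star_mult star_star)
  then obtain s where s: "psd s" "s * s = a * a" "\<And>z. z * a = a * z \<Longrightarrow> z * s = s * z"
    by (rule abs_exists) blast
  have as: "a * s = s * a" using s(3)[of a] by simp
  have ss: "star s = s" using s(1) by (rule psd_selfadj)
  from s(1) obtain k where k: "psd k" "k * k = s" "\<And>z. z * s = s * z \<Longrightarrow> z * k = k * z"
    by (rule psd_root) blast
  have ak: "a * k = k * a" using k(3) as by blast
  have sk: "star k = k" using k(1) by (rule psd_selfadj)
  have skc: "s * k = k * s" using k(3)[of s] by simp
  define m where "m = s - a"
  have sm: "star m = m" by (simp add: m_def star_diff ss sa)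
  have mk: "m * k = k * m" by (simp add: m_def algebra_simps ak skc)
  have am: "m * a = - (s * m)" by (simp add: m_def algebra_simps s(2) as)
  define y where "y = x * m"
  have "star y * y = m * a * m" by (simp add: y_def a_def star_mult sm mult.assoc)
  also have "\<dots> = - ((k * m) * (k * m))"
  proof -
    have "(k * m) * (k * m) = k * (m * k) * m" by (simp only: mult.assoc)
    also have "\<dots> = s * m * m" unfolding mk by (simp only: mult.assoc k(2)[symmetric])
    finally show ?thesis unfolding am by simp
  qed
  finally have yy: "- (star y * y) = (k * m) * (k * m)" by simp
  have skm: "star (k * m) = k * m" by (simp add: star_mult sk sm mk)
  have "psd (- (star y * y))" unfolding yy by (rule psd_square[OF skm])
  then have "y = 0" by (rule zero_if_negative_psd)
  then have "(k * m) * (k * m) = 0" using yy by simp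
  then have "k * m = 0" using skm selfadj_square_zero by blast
  then have "s * m = 0" by (simp add: k(2)[symmetric] mult.assoc)
  \<comment> \<open>Since \<open>s\<close> and \<open>a\<close> commute and have equal squares,
    \<open>s * m = 0\<close> forces \<open>m = 0\<close>, that is \<open>a = s\<close>.\<close>
  moreover have "m * m = 2 *\<^sub>R (s * m)" by (simp add: m_def algebra_simps s(2) as scaleR_2)
  ultimately have "m = 0" using selfadj_square_zero sm by simp
  then have "a = s" by (simp add: m_def)
  with s(1) show ?thesis by (simp add: a_def)
qed

lemma positive_cone_UNIV: "positive_cone (UNIV :: 'a::unital_cstar_algebra set) = Collect psd"
proof (intro equalityI subsetI)
  fix a :: 'a
  assume "a \<in> positive_cone UNIV"
  then show "a \<in> Collect psd" using psd_star_mult by (auto simp: positive_cone_def)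
next
  fix a :: 'a
  assume "a \<in> Collect psd"
  then obtain h where "star h = h" "a = h * h" by (auto simp: psd_def)
  then have "a = star h * h" by simp
  then show "a \<in> positive_cone UNIV" unfolding positive_cone_def by blast
qed

lemma psd_conj: "psd a \<Longrightarrow> psd (star c * a * c)"
proof -
  assume "psd a"
  then obtain h where "star h = h" "a = h * h" by (auto simp: psd_def)
  then have "star c * a * c = star (h * c) * (h * c)" by (simp add: star_mult mult.assoc)
  then show ?thesis using psd_star_mult by metis
qed

section \<open>Isometries in purely infinite simple algebras\<close>

text \<open>The geometric series stays in the closed algebra \<open>C\<close>, so the inverse is
  found in \<open>C\<close> and not just in the ambient algebra.\<close>

lemma neumann_inverse:
  fixes x :: "'a::unital_cstar_algebra"
  assumes C: "cstar_subalgebra C" "1 \<in> C" "x \<in> C" and nx: "norm x < 1"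
  obtains g where "g \<in> C" "g * (1 - x) = 1" "(1 - x) * g = 1"
proof -
  have sm: "summable (\<lambda>n. x ^ n)" using nx by (rule complete_algebra_summable_geometric)
  define g where "g = (\<Sum>n. x ^ n)"
  have pw: "x ^ n \<in> C" for n using C by (induction n) (auto simp: cstar_subalgebra_def)
  have part: "(\<Sum>i<n. x ^ i) \<in> C" for n
    using C pw by (induction n) (auto simp: cstar_subalgebra_def)
  have "closed C" using C by (simp add: cstar_subalgebra_def)
  then have "g \<in> C"
    unfolding g_def using part summable_LIMSEQ[OF sm] by (rule closed_sequentially)
  have "g = 1 + (\<Sum>n. x ^ Suc n)"
    unfolding g_def using suminf_split_head[OF sm] by simp
  moreover have "(\<Sum>n. x ^ Suc n) = x * g"
    unfolding g_def power_Suc by (rule suminf_mult[OF sm])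
  moreover have "(\<Sum>n. x ^ Suc n) = g * x"
    unfolding g_def power_Suc2 by (rule suminf_mult2[OF sm, symmetric])
  ultimately have gx: "g = 1 + x * g" "g = 1 + g * x" by simp_all
  have "g * (1 - x) = g - g * x" "(1 - x) * g = g - x * g" by (simp_all add: algebra_simps)
  then have "g * (1 - x) = 1" "(1 - x) * g = 1" using gx by (metis add_diff_cancel_right')+
  with \<open>g \<in> C\<close> show thesis by (rule that)
qed

lemma cstar_subalgebra_UNIV [simp]: "cstar_subalgebra UNIV"
  by (simp add: cstar_subalgebra_def)

text \<open>The finite sums of products \<open>x * f * y\<close> form an ideal, whose closure
  contains \<open>f\<close> and so is all of \<open>C\<close>. Lists of pairs encode sums of
  arbitrary length.\<close>

lemma simple_unit_approx:
  fixes f :: "'a::unital_cstar_algebra"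
  assumes C: "cstar_subalgebra C" "1 \<in> C" and simple: "simple_cstar C" and f: "f \<in> C" "f \<noteq> 0"
  obtains n :: nat and x y where "\<And>i. i < n \<Longrightarrow> x i \<in> C" "\<And>i. i < n \<Longrightarrow> y i \<in> C"
    "norm (1 - (\<Sum>i<n. x i * f * y i)) < 1"
proof -
  define s where "s ps = sum_list (map (\<lambda>(x, y). x * f * y) ps)" for ps
  define J where "J = s ` {ps. set ps \<subseteq> C \<times> C}"
  have Cadd: "a + b \<in> C" and Cmult: "a * b \<in> C" if "a \<in> C" "b \<in> C" for a b
    using C that by (auto simp: cstar_subalgebra_def)
  have Csc: "c *\<^sub>C a \<in> C" if "a \<in> C" for a c using C that by (auto simp: cstar_subalgebra_def)
  have JC: "J \<subseteq> C"
  proof -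
    have "s ps \<in> C" if "set ps \<subseteq> C \<times> C" for ps
      using that C f by (induction ps) (auto simp: s_def cstar_subalgebra_def)
    then show ?thesis by (auto simp: J_def)
  qed
  have Jadd: "a + b \<in> J" if "a \<in> J" "b \<in> J" for a b
  proof -
    from that obtain p q where pq: "a = s p" "b = s q" "set p \<subseteq> C \<times> C" "set q \<subseteq> C \<times> C"
      by (auto simp: J_def)
    then have "a + b = s (p @ q)" by (simp add: s_def)
    with pq show ?thesis by (auto simp: J_def)
  qed
  have Jmult: "b * a \<in> J" "a * b \<in> J" if "a \<in> J" "b \<in> C" for a b
  proof -
    from that obtain p where p: "a = s p" "set p \<subseteq> C \<times> C" by (auto simp: J_def)
    have "b * s p = s (map (\<lambda>(x, y). (b * x, y)) p)"
      by (induction p) (auto simp: s_def algebra_simps)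
    moreover have "set (map (\<lambda>(x, y). (b * x, y)) p) \<subseteq> C \<times> C" using p Cmult that by auto
    ultimately show "b * a \<in> J" using p by (auto simp: J_def)
    have "s p * b = s (map (\<lambda>(x, y). (x, y * b)) p)"
      by (induction p) (auto simp: s_def algebra_simps)
    moreover have "set (map (\<lambda>(x, y). (x, y * b)) p) \<subseteq> C \<times> C" using p Cmult that by auto
    ultimately show "a * b \<in> J" using p by (auto simp: J_def)
  qed
  have sc: "c *\<^sub>C a = (c *\<^sub>C 1) * a" for c and a :: 'a by (simp add: mult_scaleC_left)
  have "0 \<in> J" unfolding J_def by (rule image_eqI[of _ _ "[]"]) (auto simp: s_def)
  have "s [(1, 1)] \<in> J" unfolding J_def using C by (intro imageI) auto
  then have fJ: "f \<in> J" by (simp add: s_def)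
  have cl: "closed C" using C by (simp add: cstar_subalgebra_def)
  have clI: "a \<in> closure J" if "\<And>n. u n \<in> J" "u \<longlonglongrightarrow> a" for u a
    unfolding closure_sequential using that by (intro exI[of _ u]) simp
  have "closed_ideal_in C (closure J)"
    unfolding closed_ideal_in_def
  proof (intro conjI ballI allI)
    show "closure J \<subseteq> C" using JC cl by (rule closure_minimal)
    show "0 \<in> closure J" using \<open>0 \<in> J\<close> closure_subset by blast
    show "closed (closure J)" by simp
    have mult: "b * a \<in> closure J \<and> a * b \<in> closure J" if "a \<in> closure J" "b \<in> C" for a b
    proof -
      from that(1) obtain u where u: "\<And>n. u n \<in> J" "u \<longlonglongrightarrow> a"
        by (auto simp: closure_sequential)
      have L: "(\<lambda>n. b * u n) \<longlonglongrightarrow> b * a" "(\<lambda>n. u n * b) \<longlonglongrightarrow> a * b"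
        by (intro tendsto_mult tendsto_const u(2))+
      have "b * u n \<in> J" "u n * b \<in> J" for n using Jmult u(1) that(2) by auto
      from clI[OF this(1) L(1)] clI[OF this(2) L(2)] show ?thesis ..
    qed
    then show "b * a \<in> closure J" "a * b \<in> closure J" if "a \<in> closure J" "b \<in> C" for a b
      using that by auto
    show "c *\<^sub>C a \<in> closure J" if "a \<in> closure J" for c a
      unfolding sc[of c a] using mult[OF that Csc[OF C(2)]] by blast
    fix a b assume "a \<in> closure J" "b \<in> closure J"
    then obtain u w where uw: "\<And>n. u n \<in> J" "u \<longlonglongrightarrow> a" "\<And>n. w n \<in> J" "w \<longlonglongrightarrow> b"
      by (auto simp: closure_sequential)
    show "a + b \<in> closure J"
      using Jadd[OF uw(1) uw(3)] tendsto_add[OF uw(2) uw(4)] by (rule clI)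
  qed
  moreover have "f \<in> closure J" using fJ closure_subset[of J] by blast
  then have "closure J \<noteq> {0}" using f(2) by blast
  ultimately have "closure J = C" using simple by (auto simp: simple_cstar_def)
  then obtain j where "j \<in> J" "dist j 1 < 1"
    using C(2) closure_approachable[of 1 J] zero_less_one by blast
  then obtain ps where ps: "set ps \<subseteq> C \<times> C" "dist (s ps) 1 < 1" unfolding J_def by blast
  show thesis
  proof (rule that)
    show "fst (ps ! i) \<in> C" "snd (ps ! i) \<in> C" if "i < length ps" for i
      using ps(1) nth_mem[OF that] by auto
    show "norm (1 - (\<Sum>i<length ps. fst (ps ! i) * f * snd (ps ! i))) < 1"
      using ps(2)
      by (simp add: s_def sum_list_sum_nth case_prod_beta atLeast0LessThan dist_norm norm_minus_commute)
  qed
qed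

text \<open>
  With \<open>v\<close> implementing the equivalence of \<open>p\<close> to a proper subprojection and \<open>f = p - v v\<^sup>*\<close>,
  the translates \<open>v\<^sup>n f\<close> have orthogonal ranges below \<open>p\<close>; blocks of them are combined according to
  an expression of a unit as \<open>\<Sum> x\<^sub>i f y\<^sub>i\<close>.
\<close>

lemma infinite_projection_sequence:
  fixes p :: "'a::unital_cstar_algebra"
  assumes C: "cstar_subalgebra C" "1 \<in> C" and simple: "simple_cstar C"
    and inf: "infinite_projection C p"
  obtains l s :: "nat \<Rightarrow> 'a" where "\<And>i. l i \<in> C" "\<And>i. s i \<in> C" "\<And>i. p * s i = s i"
    "\<And>i j. l i * s j = (if i = j then 1 else 0)" "\<And>i j. i \<noteq> j \<Longrightarrow> star (s i) * s j = 0"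
proof -
  from inf obtain v q where p: "p \<in> C" "star p = p" "p * p = p"
    and v: "v \<in> C" "star v * v = p" "v * star v = q"
    and q: "star q = q" "q * q = q" "p * q = q" "q \<noteq> p"
    by (auto simp: infinite_projection_def is_projection_def)
  have Cadd: "a + b \<in> C" and Cmult: "a * b \<in> C" if "a \<in> C" "b \<in> C" for a b
    using C that by (auto simp: cstar_subalgebra_def)
  have Cstar: "star a \<in> C" if "a \<in> C" for a using C that by (auto simp: cstar_subalgebra_def)
  have Csum: "sum h {..<n} \<in> C" if "\<And>i. i < n \<Longrightarrow> h i \<in> C" for h and n :: nat
    using that C by (induction n) (auto simp: cstar_subalgebra_def)
  have Cpow: "a ^ n \<in> C" if "a \<in> C" for a n
    using that C by (induction n) (auto simp: cstar_subalgebra_def)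
  have Cminus: "a - b \<in> C" if "a \<in> C" "b \<in> C" for a b
  proof -
    have "- b = complex_of_real (-1) *\<^sub>C b" by (simp only: scaleC_of_real) simp
    then have "- b \<in> C" using C that by (auto simp: cstar_subalgebra_def)
    then show ?thesis using Cadd[of a "- b"] that by simp
  qed
  define f where "f = p - q"
  have "star (p * q) = star q" using q(3) by simp
  then have qp: "q * p = q" by (simp only: star_mult p(2) q(1))
  have ff: "f * f = f" by (simp add: f_def algebra_simps p q qp)
  have sf: "star f = f" by (simp add: f_def star_diff p q)
  have pf: "p * f = f" by (simp add: f_def algebra_simps p q)
  have fC: "f \<in> C" using Cminus Cmult Cstar p v f_def by blast
  \<comment> \<open>The C*-identity shows that \<open>v\<close> is a partial isometry with initial
    projection \<open>p\<close>.\<close>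
  have "star (v - v * p) * (v - v * p) = 0"
    by (simp add: star_diff star_mult p algebra_simps v(2)) (simp add: mult.assoc[symmetric] v(2) p)
  then have "norm (v - v * p) = 0" using cstar_identity[of "v - v * p"] by simp
  then have vp: "v * p = v" by simp
  have qv: "q * v = v" using vp by (simp add: mult.assoc v flip: v(3))
  have pv: "p * v = v" using q(3) qv by (metis mult.assoc)
  have fv: "f * v = 0" by (simp add: f_def algebra_simps pv qv)
  have vf: "star v * f = 0" using arg_cong[OF fv, of star] by (simp add: star_mult sf)
  have pvf: "p * (v ^ j * f) = v ^ j * f" for j
    by (cases j) (simp_all add: pf mult.assoc[symmetric] pv)
  have ortho: "f * star v ^ i * (v ^ j * f) = (if i = j then f else 0)" for i j
  proof (induction i arbitrary: j)
    case 0
    show ?case by (cases j) (simp_all add: ff mult.assoc[symmetric] fv)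
  next
    case (Suc i)
    show ?case
    proof (cases j)
      case 0
      have "f * star v ^ Suc i * f = f * star v ^ i * (star v * f)"
        by (simp only: power_Suc2 mult.assoc)
      then show ?thesis by (simp add: 0 vf)
    next
      case (Suc k)
      have "f * star v ^ Suc i * (v ^ Suc k * f) = f * star v ^ i * (star v * v * (v ^ k * f))"
        by (simp only: power_Suc2[of "star v"] power_Suc[of v] mult.assoc)
      then show ?thesis using Suc.IH[of k] by (simp add: Suc v(2) pvf)
    qed
  qed
  have f0: "f \<noteq> 0" using q(4) by (simp add: f_def)
  obtain n :: nat and x y where x: "\<And>i. i < n \<Longrightarrow> x i \<in> C" and y: "\<And>i. i < n \<Longrightarrow> y i \<in> C"
    and k1: "norm (1 - (\<Sum>i<n. x i * f * y i)) < 1"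
    by (rule simple_unit_approx[OF C simple fC f0]) (rule that)
  define k where "k = (\<Sum>i<n. x i * f * y i)"
  have "k \<in> C" unfolding k_def by (intro Csum Cmult x y fC)
  then have "1 - k \<in> C" using C Cminus by blast
  \<comment> \<open>\<open>k\<close> is closer than 1 to the unit, hence invertible;
    \<open>g\<close> turns the approximate relation into an exact one.\<close>
  then obtain g where g: "g \<in> C" "g * k = 1"
    using neumann_inverse[of C "1 - k"] C k1 unfolding k_def by auto
  \<comment> \<open>Block \<open>j\<close> uses the exponents from \<open>j * n\<close> to
    \<open>j * n + n - 1\<close>, so different blocks share no power of \<open>v\<close>.\<close>
  define s where "s j = (\<Sum>i<n. v ^ (i + j * n) * f * y i)" for j
  define l where "l j = g * (\<Sum>i<n. x i * (f * star v ^ (i + j * n)))" for j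
  have idx: "i + a * n = i' + b * n \<longleftrightarrow> i = i' \<and> a = b" if "i < n" "i' < n" for i i' a b :: nat
  proof
    assume eq: "i + a * n = i' + b * n"
    then have "(i + a * n) mod n = (i' + b * n) mod n" by simp
    then have "i = i'" using that by simp
    then show "i = i' \<and> a = b" using eq that by simp
  qed simp
  have ls: "l a * s b = (if a = b then 1 else 0)" for a b
  proof -
    have "l a * s b = g * (\<Sum>i<n. \<Sum>j<n. x i * (f * star v ^ (i + a * n) * (v ^ (j + b * n) * f)) * y j)"
      by (simp add: l_def s_def sum_product mult.assoc)
    also have "\<dots> = g * (\<Sum>i<n. \<Sum>j<n. if i = j \<and> a = b then x i * f * y j else 0)"
      unfolding ortho by (intro arg_cong[of _ _ "(*) g"] sum.cong refl) (auto simp: idx)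
    also have "\<dots> = g * (if a = b then k else 0)"
      by (auto simp: k_def)
    finally show ?thesis using g by simp
  qed
  have orth: "star (s a) * s b = 0" if "a \<noteq> b" for a b
  proof -
    have "star (s a) * s b =
        (\<Sum>i<n. \<Sum>j<n. star (y i) * (f * star v ^ (i + a * n) * (v ^ (j + b * n) * f)) * y j)"
      by (simp add: s_def sum_product mult.assoc star_sum star_mult sf star_power)
    also have "\<dots> = 0"
      unfolding ortho using that by (intro sum.neutral ballI) (auto simp: idx)
    finally show ?thesis .
  qed
  have ps: "p * s a = s a" for a
    by (simp add: s_def sum_distrib_left mult.assoc[symmetric] pvf[unfolded mult.assoc[symmetric]])
  have sC: "s a \<in> C" for a unfolding s_def by (intro Csum Cmult Cpow v y fC)
  have lC: "l a \<in> C" for a unfolding l_def by (intro Csum Cmult Cpow Cstar v x fC g)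
  show thesis using lC sC ps ls orth by (rule that)
qed

text \<open>The lower bound \<open>c\<close> puts \<open>b / t\<close> within distance less than 1
  of the unit, so a Neumann series gives the inverse \<open>g\<close> of \<open>b\<close>. With
  \<open>h0\<close> the root of \<open>b\<close>, \<open>g * h0\<close> is \<open>b\<close> to the
  power -1/2.\<close>

lemma inverse_root:
  fixes b :: "'a::unital_cstar_algebra"
  assumes b: "psd b" and c: "0 < c" "psd (b - c *\<^sub>R 1)"
  obtains h where "star h = h" "h * b * h = 1"
proof -
  define t where "t = norm b"
  have sb: "star b = b" using b by (rule psd_selfadj)
  have tb: "psd (t *\<^sub>R 1 - b)" unfolding t_def by (rule psd_norm_minus[OF sb order_refl])
  have "psd (t *\<^sub>R 1 - c *\<^sub>R (1::'a))" using psd_trans[OF c(2) tb] .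
  then have "psd ((t - c) *\<^sub>R (1::'a))" by (simp add: algebra_simps)
  then have t: "t > 0" using c by simp
  have "norm (t *\<^sub>R 1 - b) \<le> t - c"
    using tb c(2) by (intro norm_le_of_psd) (simp_all add: algebra_simps)
  moreover define x where "x = 1 - (1/t) *\<^sub>R b"
  have "x = (1/t) *\<^sub>R (t *\<^sub>R 1 - b)" using t by (simp add: x_def algebra_simps)
  then have "norm x = norm (t *\<^sub>R 1 - b) / t" using t by simp
  ultimately have "norm x * t < 1 * t" using t c by simp
  then have "norm x < 1" using t by (simp only: mult_less_cancel_right_pos)
  then obtain g0 where g0: "g0 * (1 - x) = 1" "(1 - x) * g0 = 1"
    using neumann_inverse[of UNIV x] by auto
  define g where "g = (1/t) *\<^sub>R g0"
  have g: "g * b = 1" "b * g = 1" using g0 by (simp_all add: g_def x_def)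
  have "star g * b = 1" using arg_cong[OF g(2), of star] by (simp add: star_mult sb)
  then have sg: "star g = g" using g by (metis mult.assoc mult.left_neutral mult.right_neutral)
  from b obtain h0 where h0: "psd h0" "h0 * h0 = b" by (rule psd_root)
  have "h0 * b = b * h0" by (simp add: mult.assoc flip: h0(2))
  then have "g * (h0 * b) * g = g * (b * h0) * g" by simp
  then have gh: "g * h0 = h0 * g" by (metis g mult.assoc mult.left_neutral mult.right_neutral)
  show thesis
  proof (rule that)
    show "star (g * h0) = g * h0" by (simp add: star_mult sg gh psd_selfadj h0)
    have "g * h0 * b * (g * h0) = g * h0 * (b * g) * h0" by (simp only: mult.assoc)
    also have "\<dots> = g * (h0 * h0)" by (simp add: g mult.assoc)
    finally show "g * h0 * b * (g * h0) = 1" by (simp add: h0 g)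
  qed
qed

section \<open>Isometries and compression below a scalar\<close>

definition isometry :: "'a::unital_cstar_algebra \<Rightarrow> bool" where
  "isometry v \<longleftrightarrow> star v * v = 1"

lemma isometryD: "isometry v \<Longrightarrow> star v * v = 1" and
  isometryD': "isometry v \<Longrightarrow> star v * (v * x) = x"
  by (simp_all add: isometry_def flip: mult.assoc)

lemma isometry_one [simp]: "isometry 1"
  by (simp add: isometry_def)

lemma isometry_mult: "isometry v \<Longrightarrow> isometry w \<Longrightarrow> isometry (v * w)"
  by (simp add: isometry_def star_mult mult.assoc isometryD'[unfolded isometry_def])

lemma isometry_norm: "isometry v \<Longrightarrow> norm v = 1"
  using cstar_identity[of v] by (simp add: isometry_def power2_eq_1_iff)
    (smt (verit) norm_ge_zero)

lemma norm_star_isometry_mult: "isometry v \<Longrightarrow> norm (star v * x) \<le> norm x"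
  using norm_mult_ineq[of "star v" x] by (simp add: isometry_norm)

lemma norm_mult_isometry: "isometry v \<Longrightarrow> norm (x * v) \<le> norm x"
  using norm_mult_ineq[of x v] by (simp add: isometry_norm)

lemma isometry_range_psd:
  fixes v :: "'a::unital_cstar_algebra"
  assumes "isometry v"
  shows "psd (1 - v * star v)"
proof -
  let ?q = "1 - v * star v"
  have "star ?q = ?q" by (simp add: star_diff star_mult star_star)
  moreover have "?q * ?q = ?q" using assms by (simp add: algebra_simps mult.assoc isometryD')
  ultimately show ?thesis unfolding psd_def by metis
qed

text \<open>Polar decomposition: the left inverse \<open>l i\<close> bounds
  \<open>star (s i) * s i\<close> below by \<open>1 / (norm (l i))\<^sup>2\<close>, so
  \<open>s i\<close> can be multiplied on the right by the inverse root of
  \<open>star (s i) * s i\<close>. This preserves the orthogonality and the range below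
  \<open>p\<close>.\<close>

lemma infinite_projection_isometries:
  fixes p :: "'a::unital_cstar_algebra"
  assumes simple: "simple_cstar (UNIV :: 'a set)" and inf: "infinite_projection UNIV p"
  obtains t :: "nat \<Rightarrow> 'a" where "\<And>i. isometry (t i)" "\<And>i. p * t i = t i"
    "\<And>i j. i \<noteq> j \<Longrightarrow> star (t i) * t j = 0"
proof -
  obtain l s :: "nat \<Rightarrow> 'a" where "\<And>i. l i \<in> UNIV" "\<And>i. s i \<in> UNIV" and ps: "\<And>i. p * s i = s i"
    and ls: "\<And>i j. l i * s j = (if i = j then 1 else 0)"
    and orth: "\<And>i j. i \<noteq> j \<Longrightarrow> star (s i) * s j = 0"
    by (rule infinite_projection_sequence[OF cstar_subalgebra_UNIV UNIV_I simple inf]) (rule that)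
  have "\<exists>h. star h = h \<and> h * (star (s i) * s i) * h = 1" for i
  proof -
    define L where "L = (norm (l i))\<^sup>2"
    have "l i \<noteq> 0" using ls[of i i] by auto
    then have L: "L > 0" by (simp add: L_def)
    have "psd (L *\<^sub>R 1 - star (l i) * l i)"
      by (rule psd_norm_minus) (simp_all add: star_mult star_star L_def cstar_identity)
    then have "psd (star (s i) * (L *\<^sub>R 1 - star (l i) * l i) * s i)" by (rule psd_conj)
    also have "star (s i) * (L *\<^sub>R 1 - star (l i) * l i) * s i =
        L *\<^sub>R (star (s i) * s i) - star (l i * s i) * (l i * s i)"
      by (simp add: algebra_simps star_mult)
    also have "\<dots> = L *\<^sub>R (star (s i) * s i - (1/L) *\<^sub>R 1)"
      using L by (simp add: ls algebra_simps)
    finally have "psd (L *\<^sub>R (star (s i) * s i - (1/L) *\<^sub>R 1))" .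
    from psd_scaleR[OF this, of "1/L"] have "psd (star (s i) * s i - (1/L) *\<^sub>R 1)"
      using L unfolding scaleR_scaleR by simp
    moreover have "0 < 1/L" using L by simp
    ultimately obtain h where "star h = h" "h * (star (s i) * s i) * h = 1"
      using inverse_root[OF psd_star_mult] by blast
    then show ?thesis by blast
  qed
  then obtain h where h: "\<And>i. star (h i) = h i" "\<And>i. h i * (star (s i) * s i) * h i = 1" by metis
  show thesis
  proof (rule that[of "\<lambda>i. s i * h i"])
    show "isometry (s i * h i)" for i
      using h(2)[of i] by (simp add: isometry_def star_mult h(1) mult.assoc)
    show "p * (s i * h i) = s i * h i" for i by (simp add: ps flip: mult.assoc)
    show "star (s i * h i) * (s j * h j) = 0" if "i \<noteq> j" for i j
    proof -
      have "star (s i * h i) * (s j * h j) = h i * (star (s i) * s j) * h j"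
        by (simp add: star_mult h(1) mult.assoc)
      then show ?thesis by (simp add: orth[OF that])
    qed
  qed
qed

lemma hereditary_subalgebra_self: "hereditary_subalgebra B B" if "cstar_subalgebra B"
  using that by (simp add: hereditary_subalgebra_def positive_cone_def cstar_subalgebra_def)

lemma purely_infinite_infinite_projection:
  assumes "purely_infinite B" "cstar_subalgebra B" "simple_cstar B"
  obtains p where "infinite_projection B p"
proof -
  have "hereditary_subalgebra B B \<and> B \<noteq> {0}"
    using assms hereditary_subalgebra_self by (simp add: simple_cstar_def)
  with assms(1) have "\<exists>p\<in>B. infinite_projection B p" unfolding purely_infinite_def by (elim allE impE)
  with that show thesis by blast
qed

text \<open>If \<open>0 \<le> b \<le> h\<close> and \<open>h\<close> annihilates \<open>m\<close>,
  then \<open>m * b * m\<close> lies between 0 and \<open>m * h * m = 0\<close>. Hence a root of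
  \<open>b\<close> annihilates \<open>m\<close>, and so does \<open>b\<close>.\<close>

lemma annihilator_hereditary:
  fixes m :: "'a::unital_cstar_algebra"
  assumes sm: "star m = m"
  shows "hereditary_subalgebra UNIV {z. z * m = 0 \<and> m * z = 0}" (is "hereditary_subalgebra _ ?H")
  unfolding hereditary_subalgebra_def
proof (intro conjI ballI impI)
  show "cstar_subalgebra ?H" unfolding cstar_subalgebra_def
  proof (intro conjI ballI allI)
    show "star z \<in> ?H" if "z \<in> ?H" for z
    proof -
      have "star (m * z) = 0" "star (z * m) = 0" using that by simp_all
      then show ?thesis by (simp add: star_mult sm)
    qed
    show "x * y \<in> ?H" if "x \<in> ?H" "y \<in> ?H" for x y
      using that by (simp add: mult.assoc) (simp flip: mult.assoc)
    have "closed ({z. z * m = 0} \<inter> {z. m * z = 0})"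
      by (intro closed_Int closed_Collect_eq continuous_intros)
    then show "closed ?H" by (simp add: Collect_conj_eq)
  qed (auto simp: algebra_simps mult_scaleC_left mult_scaleC_right)
  fix h b
  assume h: "h \<in> ?H" and "b \<in> positive_cone UNIV \<and> h - b \<in> positive_cone UNIV"
  then have b: "psd b" and hb: "psd (h - b)" by (auto simp: positive_cone_UNIV)
  have mbm: "psd (m * b * m)" using psd_conj[OF b, of m] by (simp add: sm)
  have "m * (h - b) * m = - (m * b * m)" using h by (simp add: algebra_simps)
  then have "psd (- (m * b * m))" using psd_conj[OF hb, of m] by (simp add: sm)
  then have mbm0: "m * b * m = 0" using psd_antisym mbm by blast
  obtain k where k: "star k = k" "b = k * k" using b by (auto simp: psd_def)
  have "star (k * m) * (k * m) = 0" using mbm0 by (simp add: star_mult k sm mult.assoc)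
  then have "k * m = 0" using cstar_identity[of "k * m"] by simp
  then have bm: "b * m = 0" by (simp add: k mult.assoc)
  have "star (b * m) = 0" using bm by simp
  then have "m * b = 0" by (simp only: star_mult sm psd_selfadj[OF b])
  then show "b \<in> ?H" using bm by simp
qed simp

text \<open>
  With \<open>a = e - c\<close>, the isometry comes from an infinite projection annihilating \<open>|a| - a\<close>.
\<close>

lemma isometry_compression:
  fixes c :: "'a::unital_cstar_algebra"
  assumes simple: "simple_cstar (UNIV :: 'a set)" and pi: "purely_infinite (UNIV :: 'a set)"
    and sc: "star c = c" and nc: "\<not> psd (c - e *\<^sub>R 1)"
  obtains r where "isometry r" "psd (e *\<^sub>R 1 - star r * c * r)"
proof -
  define a where "a = e *\<^sub>R 1 - c"
  have sa: "star a = a" by (simp add: a_def star_diff star_scaleR sc)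
  then obtain s where s: "psd s" "s * s = a * a" and com: "\<And>z. z * a = a * z \<Longrightarrow> z * s = s * z"
    by (rule abs_exists) blast
  have as: "a * s = s * a" using com[of a] by simp
  define m where "m = s - a"
  have sm: "star m = m" by (simp add: m_def star_diff sa psd_selfadj s)
  let ?H = "{z. z * m = 0 \<and> m * z = 0}"
  \<comment> \<open>\<open>s + a\<close> is twice the positive part of \<open>a\<close> and
    annihilates \<open>m\<close>. If it vanished, \<open>c - e *\<^sub>R 1\<close> would equal
    \<open>s\<close> and be positive.\<close>
  have "s + a \<noteq> 0"
  proof
    assume "s + a = 0"
    then have "s = c - e *\<^sub>R 1" unfolding a_def by (simp add: eq_neg_iff_add_eq_0[symmetric])
    then show False using s(1) nc by simp
  qed
  moreover have "s + a \<in> ?H" by (simp add: m_def algebra_simps s(2) as)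
  ultimately have "?H \<noteq> {0}" by blast
  then obtain p where p: "p \<in> ?H" "infinite_projection UNIV p"
    using pi annihilator_hereditary[OF sm] unfolding purely_infinite_def by blast
  obtain t :: "nat \<Rightarrow> 'a" where t: "\<And>i. isometry (t i)" "\<And>i. p * t i = t i"
      "\<And>i j. i \<noteq> j \<Longrightarrow> star (t i) * t j = 0"
    by (rule infinite_projection_isometries[OF simple p(2)]) (rule that)
  define r where "r = t 0"
  have r: "isometry r" "p * r = r" by (simp_all add: r_def t)
  \<comment> \<open>On the range of \<open>r\<close> the element \<open>a\<close> agrees with its
    absolute value \<open>s\<close>.\<close>
  have "m * r = m * p * r" by (simp add: r(2) mult.assoc)
  then have "m * r = 0" using p by simp
  then have "a * r = s * r" by (simp add: m_def algebra_simps)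
  then have "star r * a * r = star r * s * r" by (simp add: mult.assoc)
  moreover have "star r * a * r = e *\<^sub>R 1 - star r * c * r"
    using r(1) by (simp add: a_def algebra_simps isometryD)
  ultimately show thesis using that r(1) psd_conj[OF s(1), of r] by simp
qed

section \<open>Expectations of finite index\<close>

text \<open>The index constant is fixed as \<open>ind\<close>. Membership of the unit in
  \<open>B\<close> is assumed here and is supplied by \<open>irreducible_unit_mem\<close>.\<close>

locale finite_index_expectation =
  fixes B :: "'a::unital_cstar_algebra set" and E :: "'a \<Rightarrow> 'a" and ind :: real
  assumes subalg: "cstar_subalgebra B" and one_mem: "1 \<in> B"
    and simple_UNIV: "simple_cstar (UNIV :: 'a set)" and pi_UNIV: "purely_infinite (UNIV :: 'a set)"
    and simple_B: "simple_cstar B" and pi_B: "purely_infinite B"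
    and irreducible: "irreducible_inclusion B"
    and expectation: "conditional_expectation B E"
    and index_ge_one: "ind \<ge> 1" and index: "positive_map (\<lambda>x. E x - inverse ind *\<^sub>R x)"
begin

lemma index_pos: "ind > 0"
  using index_ge_one by simp

lemma E_add: "E (x + y) = E x + E y"
  and E_scaleC: "E (c *\<^sub>C x) = c *\<^sub>C E x"
  and E_mem: "E x \<in> B"
  and E_id: "b \<in> B \<Longrightarrow> E b = b"
  and E_left: "b \<in> B \<Longrightarrow> E (b * x) = b * E x"
  and E_right: "b \<in> B \<Longrightarrow> E (x * b) = E x * b"
  and E_norm: "norm (E x) \<le> norm x"
  using expectation by (auto simp: conditional_expectation_def)

lemma E_scaleR: "E (r *\<^sub>R x) = r *\<^sub>R E x"
  using E_scaleC[of "complex_of_real r" x] by (simp only: scaleC_of_real)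

lemma E_minus: "E (- x) = - E x"
  using E_scaleR[of "-1" x] by simp

lemma E_diff: "E (x - y) = E x - E y"
  using E_add[of x "- y"] by (simp add: E_minus)

lemma E_zero: "E 0 = 0"
  using E_scaleR[of 0 0] by simp

lemma E_sum: "E (sum h S) = (\<Sum>i\<in>S. E (h i))"
  by (induction S rule: infinite_finite_induct) (simp_all add: E_zero E_add)

lemma E_root:
  obtains k where "k \<in> B" "E (star x * x) = star k * k"
proof -
  have "star x * x \<in> positive_cone UNIV" by (auto simp: positive_cone_def)
  then have "E (star x * x) \<in> positive_cone B"
    using expectation by (simp add: conditional_expectation_def)
  with that show thesis by (auto simp: positive_cone_def)
qed

lemma E_psd: "psd x \<Longrightarrow> psd (E x)"
proof -
  assume "psd x"
  then obtain h where "star h = h" "x = h * h" by (auto simp: psd_def)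
  then have "x = star h * h" by simp
  then obtain k where "E x = star k * k" using E_root[of h] by metis
  then show ?thesis by (simp add: psd_star_mult)
qed

text \<open>A self-adjoint \<open>a\<close> becomes positive after adding
  \<open>norm a *\<^sub>R 1\<close>, which \<open>E\<close> fixes; the general case follows by
  cartesian decomposition.\<close>

lemma E_star: "E (star x) = star (E x)"
proof -
  have sa: "star (E a) = E a" if a: "star a = a" for a
  proof -
    have "psd (norm a *\<^sub>R 1 + a)" by (rule psd_norm_plus[OF a order_refl])
    then have "star (E (norm a *\<^sub>R 1 + a)) = E (norm a *\<^sub>R 1 + a)"
      by (intro psd_selfadj E_psd)
    then show ?thesis by (simp add: E_add E_scaleR E_id[OF one_mem] star_add star_scaleR)
  qed
  obtain h k where hk: "star h = h" "star k = k" "x = h + \<i> *\<^sub>C k"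
    by (rule cartesian_decomposition)
  have "star x = h - \<i> *\<^sub>C k" by (simp add: hk star_add star_iscale)
  then show ?thesis
    by (simp add: hk(3) E_add E_diff E_scaleC star_add star_iscale sa[OF hk(1)] sa[OF hk(2)])
qed

lemma index_psd: "psd x \<Longrightarrow> psd (E x - inverse ind *\<^sub>R x)"
  using index by (simp add: positive_map_def positive_cone_UNIV)

lemma norm_le_index: "psd x \<Longrightarrow> norm x \<le> ind * norm (E x)"
proof -
  assume x: "psd x"
  have "norm (inverse ind *\<^sub>R x) \<le> norm (E x)"
    using index_pos by (intro norm_mono_psd psd_scaleR x index_psd) auto
  then show ?thesis using index_pos by (simp add: field_simps)
qed

text \<open>
  The maps \<open>a \<mapsto> R E(S a)\<close> play the role of the rank one operators of the basic construction, and
  \<open>S\<^sup>* E(R\<^sup>* R) S\<close> that of the dual expectation of their absolute squares.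
\<close>

lemma rank_one_bound:
  "(norm (R * E (S * a)))\<^sup>2 \<le> ind * norm (star S * E (star R * R) * S) * (norm a)\<^sup>2"
proof -
  obtain k where k: "k \<in> B" "E (star R * R) = star k * k" by (rule E_root)
  define z where "z = R * E (S * a)"
  define u where "u = k * S * a"
  have Eu: "E u = k * E (S * a)" by (simp add: u_def mult.assoc E_left k)
  have starE: "star (E x) \<in> B" for x using E_mem subalg by (simp add: cstar_subalgebra_def)
  have "star z * z = star (E (S * a)) * (star R * R * E (S * a))"
    by (simp add: z_def star_mult mult.assoc)
  then have "E (star z * z) = star (E (S * a)) * (E (star R * R) * E (S * a))"
    by (simp add: E_left[OF starE] E_right[OF E_mem])
  then have zz: "E (star z * z) = star (E u) * E u"
    by (simp add: k Eu star_mult mult.assoc)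
  \<comment> \<open>Expanding this positive element gives the Schwarz inequality for
    \<open>E\<close>.\<close>
  have "E (star (u - E u) * (u - E u)) = E (star u * u) - star (E u) * E u"
    by (simp add: star_diff algebra_simps E_add E_diff E_left[OF starE] E_right[OF E_mem] E_star
        E_left[OF E_mem] E_id[OF E_mem] E_id[OF starE])
  then have "psd (E (star u * u) - star (E u) * E u)"
    using E_psd[OF psd_star_mult[of "u - E u"]] by simp
  then have "norm (star (E u) * E u) \<le> norm (E (star u * u))"
    by (intro norm_mono_psd psd_star_mult)
  also have "\<dots> \<le> norm (star u * u)" by (rule E_norm)
  also have "star u * u = star a * (star S * E (star R * R) * S) * a"
    by (simp add: u_def k star_mult mult.assoc)
  also have "norm \<dots> \<le> norm a * norm (star S * E (star R * R) * S) * norm a"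
    using norm_mult_ineq[of "star a * (star S * E (star R * R) * S)" a]
      norm_mult_ineq[of "star a" "star S * E (star R * R) * S"]
    by (smt (verit) mult_right_mono norm_ge_zero norm_star)
  finally have "norm (E (star z * z)) \<le> norm (star S * E (star R * R) * S) * (norm a)\<^sup>2"
    unfolding zz by (simp add: power2_eq_square mult_ac)
  then have "ind * norm (E (star z * z)) \<le> ind * (norm (star S * E (star R * R) * S) * (norm a)\<^sup>2)"
    using index_pos by (simp add: mult_left_mono)
  \<comment> \<open>Finite index converts the bound on \<open>E (star z * z)\<close> into one on
    \<open>z\<close>.\<close>
  moreover have "(norm z)\<^sup>2 \<le> ind * norm (E (star z * z))"
    using norm_le_index[OF psd_star_mult[of z]] by (simp add: cstar_identity)
  ultimately show ?thesis by (simp add: z_def mult.assoc)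
qed

section \<open>Compressions and their weights\<close>

definition compress :: "'a \<Rightarrow> 'a \<Rightarrow> 'a" where
  "compress d a = star d * E (d * a)"

definition weight :: "'a \<Rightarrow> 'a" where
  "weight d = star d * E (d * star d) * d"

text \<open>The weight of the difference \<open>compress f - compress g\<close>, written out because
  that difference need not be of the form \<open>compress d\<close>.\<close>

definition distance_weight :: "'a \<Rightarrow> 'a \<Rightarrow> 'a" where
  "distance_weight f g = weight f + weight g
     - star f * E (f * star g) * g - star g * E (g * star f) * f"

lemma weight_psd: "psd (weight d)"
proof -
  have "psd (E (star (star d) * star d))" by (intro E_psd psd_star_mult)
  then show ?thesis unfolding weight_def star_star by (rule psd_conj)
qed

lemma weight_norm_le: "isometry d \<Longrightarrow> norm (weight d) \<le> norm (E (d * star d))"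
  unfolding weight_def
  by (metis mult.assoc norm_mult_isometry norm_star_isometry_mult order_trans)

text \<open>As \<open>c * star c \<le> 1\<close>, positivity of \<open>E\<close> gives
  \<open>E (d * c * star c * star d) \<le> E (d * star d)\<close>; conjugation by
  \<open>d * c\<close> finishes.\<close>

lemma weight_mult_psd:
  assumes "isometry c"
  shows "psd (star c * weight d * c - weight (d * c))"
proof -
  have "psd (star (star d) * (1 - c * star c) * star d)"
    by (intro psd_conj isometry_range_psd assms)
  then have "psd (E (d * (1 - c * star c) * star d))" by (simp add: star_star E_psd)
  then have "psd (star (d * c) * E (d * (1 - c * star c) * star d) * (d * c))" by (rule psd_conj)
  also have "star (d * c) * E (d * (1 - c * star c) * star d) * (d * c)
      = star c * weight d * c - weight (d * c)"
    by (simp add: weight_def star_mult algebra_simps E_diff)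
  finally show ?thesis .
qed

lemma weight_mult_norm_le:
  assumes "isometry c"
  shows "norm (weight (d * c)) \<le> norm (weight d)"
proof -
  have "norm (weight (d * c)) \<le> norm (star c * weight d * c)"
    by (intro norm_mono_psd weight_psd weight_mult_psd assms)
  also have "\<dots> \<le> norm (weight d)"
    using norm_mult_isometry[OF assms, of "star c * weight d"]
      norm_star_isometry_mult[OF assms, of "weight d"] by linarith
  finally show ?thesis .
qed

text \<open>Pure infiniteness of \<open>B\<close> provides \<open>l i\<close> and \<open>s i\<close>
  in \<open>B\<close> with \<open>l i * s j\<close> equal to 1 or 0 according to whether
  \<open>i = j\<close>. Since they pass through \<open>E\<close>, the two-term difference becomes a
  single map \<open>a \<mapsto> R * E (S * a)\<close>, to which \<open>rank_one_bound\<close>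
  applies.\<close>

lemma distance_weight:
  shows distance_weight_psd: "psd (distance_weight f g)"
    and compress_diff_bound:
      "(norm (compress f a - compress g a))\<^sup>2 \<le> ind * norm (distance_weight f g) * (norm a)\<^sup>2"
proof -
  obtain p where "infinite_projection B p"
    using purely_infinite_infinite_projection[OF pi_B subalg simple_B] by blast
  then obtain l s :: "nat \<Rightarrow> 'a" where lB: "\<And>i. l i \<in> B" and sB: "\<And>i. s i \<in> B"
    and "\<And>i. p * s i = s i"
    and ls: "\<And>i j. l i * s j = (if i = j then 1 else 0)"
    and "\<And>i j. i \<noteq> j \<Longrightarrow> star (s i) * s j = 0"
    by (rule infinite_projection_sequence[OF subalg one_mem simple_B]) (rule that)
  define R where "R = star f * l 0 - star g * l 1"
  define S where "S = s 0 * f + s 1 * g"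
  have slB: "star (l i) \<in> B" for i using lB subalg by (simp add: cstar_subalgebra_def)
  have ls': "l i * (s j * x) = (if i = j then x else 0)" for i j x
    by (simp add: ls flip: mult.assoc)
  have "star (l i * s j) = (if i = j then 1 else 0)" for i j by (simp add: ls)
  then have sl: "star (s j) * star (l i) = (if i = j then 1 else 0)" for i j
    by (simp only: star_mult)
  have sl': "star (s j) * (star (l i) * x) = (if i = j then x else 0)" for i j x
    by (simp add: sl flip: mult.assoc)
  have compress_eq: "R * E (S * a) = compress f a - compress g a" for a
    unfolding R_def S_def compress_def
    by (simp add: algebra_simps E_add E_left[OF sB] ls')
  have "star R * R = star (l 0) * (f * star f * l 0) - star (l 0) * (f * star g * l 1)
      - star (l 1) * (g * star f * l 0) + star (l 1) * (g * star g * l 1)"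
    by (simp add: R_def star_diff star_mult star_star algebra_simps)
  then have ER: "E (star R * R) = star (l 0) * (E (f * star f) * l 0) - star (l 0) * (E (f * star g) * l 1)
      - star (l 1) * (E (g * star f) * l 0) + star (l 1) * (E (g * star g) * l 1)"
    by (simp only: E_add E_diff E_left[OF slB] E_right[OF lB])
  then have weight_eq: "star S * E (star R * R) * S = distance_weight f g"
    unfolding distance_weight_def weight_def ER
    by (simp add: S_def star_add star_mult algebra_simps ls' sl')
  show "psd (distance_weight f g)"
    unfolding weight_eq[symmetric] by (intro psd_conj E_psd psd_star_mult)
  show "(norm (compress f a - compress g a))\<^sup>2 \<le> ind * norm (distance_weight f g) * (norm a)\<^sup>2"
    using rank_one_bound[of R S a] by (simp only: compress_eq weight_eq)
qed

section \<open>Decoupled restrictions and near-minimal weight\<close>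

definition decoupled :: "real \<Rightarrow> 'a \<Rightarrow> 'a \<Rightarrow> bool" where
  "decoupled \<kappa> f g \<longleftrightarrow> (\<forall>a. norm (star f * E (g * a)) \<le> \<kappa> * norm a)"

lemma decoupled_mult:
  assumes "decoupled \<kappa> f g" "isometry c" "isometry d"
  shows "decoupled \<kappa> (f * c) (g * d)"
  unfolding decoupled_def
proof
  fix a
  have "norm (star (f * c) * E (g * d * a)) \<le> norm (star f * E (g * (d * a)))"
    using norm_star_isometry_mult[OF assms(2)] by (simp add: star_mult mult.assoc)
  also have "\<dots> \<le> \<kappa> * norm (d * a)" using assms(1) by (simp add: decoupled_def)
  also have "norm (d * a) = norm a"
  proof -
    have "star (d * a) * (d * a) = star a * a"
      using assms(3) by (simp add: star_mult mult.assoc isometryD')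
    then have "(norm (d * a))\<^sup>2 = (norm a)\<^sup>2" by (simp flip: cstar_identity)
    then show ?thesis by simp
  qed
  finally show "norm (star (f * c) * E (g * d * a)) \<le> \<kappa> * norm a" .
qed

lemma decoupled_bound:
  assumes "decoupled \<kappa> f g" "isometry h" "isometry k"
  shows "norm (star f * E (g * star h) * k) \<le> \<kappa>" "norm (star k * E (h * star g) * f) \<le> \<kappa>"
proof -
  have "norm (star f * E (g * star h)) \<le> \<kappa> * norm (star h)"
    using assms(1) unfolding decoupled_def by blast
  then have "norm (star f * E (g * star h)) \<le> \<kappa>" using assms(2) by (simp add: isometry_norm)
  then show 1: "norm (star f * E (g * star h) * k) \<le> \<kappa>"
    using norm_mult_isometry[OF assms(3)] order_trans by blast
  have "star (star f * E (g * star h) * k) = star k * E (h * star g) * f"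
    by (simp add: star_mult star_star mult.assoc flip: E_star)
  then show "norm (star k * E (h * star g) * f) \<le> \<kappa>" using 1 norm_star by metis
qed

text \<open>The parallelogram identity, up to cross terms that decoupling makes small.\<close>

lemma distance_weight_bound:
  assumes iso: "isometry f" "isometry g"
    and dec: "decoupled \<kappa> f g" "decoupled \<kappa> g f"
    and M: "norm (weight f) \<le> M" "norm (weight g) \<le> M"
    and m: "psd (weight (f + g) - m *\<^sub>R 1)"
  shows "norm (distance_weight f g) \<le> 4 * M + 12 * \<kappa> - m"
proof -
  define w where "w a b c d = star a * E (b * star c) * d" for a b c d
  \<comment> \<open>Of the sixteen terms of \<open>weight (f + g)\<close>, these are the twelve
    whose first two or last two letters differ. Decoupling bounds each by \<open>\<kappa>\<close>;
    the other four enter \<open>distance_weight\<close> and the two weights.\<close>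
  define R where "R = (w f g f f + w f g f g + w f g g f + w f g g g)
      + (w g f f f + w g f f g + w g f g f + w g f g g)
      + (w f f f g + w f f g f + w g g f g + w g g g f)"
  have R_eq: "R = weight (f + g) + distance_weight f g - 2 *\<^sub>R weight f - 2 *\<^sub>R weight g"
    unfolding R_def w_def distance_weight_def weight_def
    by (simp add: star_add algebra_simps E_add scaleR_2)
  have bd: "norm (w f g h k) \<le> \<kappa>" "norm (w g f h k) \<le> \<kappa>"
      "norm (w k h g f) \<le> \<kappa>" "norm (w k h f g) \<le> \<kappa>"
    if "isometry h" "isometry k" for h k
    unfolding w_def using that decoupled_bound[OF dec(1)] decoupled_bound[OF dec(2)] by auto
  have n4: "norm (x1 + x2 + x3 + x4) \<le> 4 * \<kappa>"
    if "norm x1 \<le> \<kappa>" "norm x2 \<le> \<kappa>" "norm x3 \<le> \<kappa>" "norm x4 \<le> \<kappa>" for x1 x2 x3 x4 :: 'a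
    using norm_triangle_le[OF add_mono[OF norm_triangle_le[OF add_mono[OF
      norm_triangle_le[OF add_mono[OF that(1,2)]] that(3)]] that(4)]] by simp
  have "norm (w f g f f + w f g f g + w f g g f + w f g g g) \<le> 4 * \<kappa>"
    by (intro n4 bd iso)
  moreover have "norm (w g f f f + w g f f g + w g f g f + w g f g g) \<le> 4 * \<kappa>"
    by (intro n4 bd iso)
  moreover have "norm (w f f f g + w f f g f + w g g f g + w g g g f) \<le> 4 * \<kappa>"
    by (intro n4 bd iso)
  ultimately have nR: "norm R \<le> 12 * \<kappa>"
    unfolding R_def by norm
  have sR: "star R = R"
    unfolding R_eq by (simp add: star_add star_diff star_scaleR psd_selfadj weight_psd distance_weight_psd)
  have "psd (M *\<^sub>R 1 - weight f)" "psd (M *\<^sub>R 1 - weight g)"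
    by (intro psd_norm_minus psd_selfadj weight_psd M)+
  from psd_scaleR[OF this(1), of 2] psd_scaleR[OF this(2), of 2]
  have "psd ((2 *\<^sub>R (M *\<^sub>R 1 - weight f) + 2 *\<^sub>R (M *\<^sub>R 1 - weight g))
      + (weight (f + g) - m *\<^sub>R 1) + ((12 * \<kappa>) *\<^sub>R 1 - R))"
    by (intro psd_add m psd_norm_minus[OF sR nR]) auto
  also have "(2 *\<^sub>R (M *\<^sub>R 1 - weight f) + 2 *\<^sub>R (M *\<^sub>R 1 - weight g))
      + (weight (f + g) - m *\<^sub>R 1) + ((12 * \<kappa>) *\<^sub>R 1 - R)
    = (4 * M + 12 * \<kappa> - m) *\<^sub>R 1 - distance_weight f g"
    unfolding R_eq by (simp add: algebra_simps) (simp flip: scaleR_add_left)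
  finally show ?thesis by (rule norm_le_of_psd[OF distance_weight_psd])
qed

text \<open>
  Among many orthogonal isometries \<open>t\<^sub>i\<close>, whose ranges add up to at most the unit, one has a
  small contribution \<open>E(d t\<^sub>i t\<^sub>i\<^sup>* d\<^sup>*)\<close> somewhere.
\<close>

lemma decoupled_exists:
  assumes d: "isometry d" and \<kappa>: "\<kappa> > 0"
  obtains r q where "isometry r" "isometry q" "star r * q = 0"
    "decoupled \<kappa> (d * r) (d * q)" "decoupled \<kappa> (d * q) (d * r)"
proof -
  \<comment> \<open>\<open>\<mu>\<close> bounds the map from \<open>g\<close> to \<open>f\<close>.
    The reverse map is then estimated through \<open>rank_one_bound\<close>, whose square root
    accounts for \<open>\<kappa>\<^sup>2 / ind\<close>.\<close>
  define \<mu> where "\<mu> = min \<kappa> (\<kappa>\<^sup>2 / ind)"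
  have \<mu>: "\<mu> > 0" "\<mu> \<le> \<kappa>" "ind * \<mu> \<le> \<kappa>\<^sup>2"
    using \<kappa> index_pos by (auto simp: \<mu>_def min_def field_simps)
  obtain p0 :: 'a where "infinite_projection UNIV p0"
    using purely_infinite_infinite_projection[OF pi_UNIV cstar_subalgebra_UNIV simple_UNIV] by blast
  then obtain t :: "nat \<Rightarrow> 'a" where t: "\<And>i. isometry (t i)"
    and "\<And>i. p0 * t i = t i" and orth: "\<And>i j. i \<noteq> j \<Longrightarrow> star (t i) * t j = 0"
    by (rule infinite_projection_isometries[OF simple_UNIV]) (rule that)
  obtain N :: nat where N: "2 * ind / \<mu>\<^sup>2 < real N" using reals_Archimedean2 by blast
  have N0: "real N > 0"
    using N index_pos by (smt (verit) divide_nonneg_nonneg zero_le_power2)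
  have indN: "ind * (2 / N) \<le> \<mu>\<^sup>2"
    using N N0 \<mu>(1) by (simp add: field_simps)
  \<comment> \<open>Index 0 is reserved for the second restriction; searching over
    \<open>1..N\<close> keeps the two ranges orthogonal.\<close>
  define e where "e = d * t 0"
  have e: "isometry e" unfolding e_def by (intro isometry_mult d t)
  define a where "a k = star e * E (d * t k * star (d * t k)) * e" for k
  have a_psd: "psd (a k)" for k
    unfolding a_def using psd_star_mult[of "star (d * t k)"]
    by (intro psd_conj E_psd) (simp add: star_star)
  \<comment> \<open>If every \<open>a k\<close> were at least \<open>2 / N\<close>, their sum would
    be at least 2, whereas it lies below \<open>star e * E (d * star d) * e\<close>, of norm at most
    1.\<close>
  have "\<exists>k\<in>{1..N}. \<not> psd (a k - (2 / N) *\<^sub>R 1)"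
  proof (rule ccontr)
    assume "\<not> ?thesis"
    then have "psd (\<Sum>k\<in>{1..N}. a k - (2 / N) *\<^sub>R 1)" by (intro psd_sum) auto
    then have lower: "psd ((\<Sum>k\<in>{1..N}. a k) - 2 *\<^sub>R 1)"
    proof -
      have "(\<Sum>k\<in>{1..N}. (2 / N) *\<^sub>R (1::'a)) = 2 *\<^sub>R 1"
        unfolding sum_constant_scaleR using N0 by (simp only: scaleR_scaleR) simp
      with \<open>psd (\<Sum>k\<in>{1..N}. a k - (2 / N) *\<^sub>R 1)\<close> show ?thesis by (simp only: sum_subtractf)
    qed
    define Q where "Q = (\<Sum>k\<in>{1..N}. t k * star (t k))"
    have sQ: "star Q = Q" by (simp add: Q_def star_sum star_mult star_star)
    have "Q * Q = (\<Sum>k\<in>{1..N}. \<Sum>j\<in>{1..N}. t k * (star (t k) * t j) * star (t j))"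
      by (simp add: Q_def sum_product mult.assoc)
    also have "\<dots> = (\<Sum>k\<in>{1..N}. \<Sum>j\<in>{1..N}. if k = j then t k * star (t j) else 0)"
      by (intro sum.cong refl) (auto simp: orth isometryD[OF t])
    also have "\<dots> = Q" by (simp add: Q_def)
    finally have QQ: "Q * Q = Q" .
    have "(1 - Q) * (1 - Q) = 1 - Q" by (simp add: algebra_simps QQ)
    moreover have "star (1 - Q) = 1 - Q" by (simp add: star_diff sQ)
    ultimately have "psd (1 - Q)" unfolding psd_def by metis
    then have "psd (star (star d) * (1 - Q) * star d)" by (rule psd_conj)
    then have "psd (E (d * (1 - Q) * star d))" by (simp add: star_star E_psd)
    then have "psd (star e * E (d * (1 - Q) * star d) * e)" by (rule psd_conj)
    also have "star e * E (d * (1 - Q) * star d) * e =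
        star e * E (d * star d) * e - (\<Sum>k\<in>{1..N}. a k)"
      by (simp add: a_def Q_def algebra_simps E_diff E_sum star_mult sum_distrib_left sum_distrib_right)
    finally have upper: "psd (star e * E (d * star d) * e - (\<Sum>k\<in>{1..N}. a k))" .
    have "psd (star e * E (d * star d) * e - 2 *\<^sub>R 1)" by (rule psd_trans[OF lower upper])
    moreover have "norm (star e * E (d * star d) * e) \<le> 1"
    proof -
      have "norm (E (d * star d)) \<le> norm (d * star d)" by (rule E_norm)
      also have "\<dots> = 1" using d by (simp add: cstar_identity' isometry_norm)
      finally show ?thesis
        using norm_mult_isometry[OF e, of "star e * E (d * star d)"]
          norm_star_isometry_mult[OF e, of "E (d * star d)"] by linarith
    qed
    then have "psd (1 *\<^sub>R 1 - star e * E (d * star d) * e)"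
      by (intro psd_norm_minus) (simp_all add: star_mult star_star mult.assoc flip: E_star)
    ultimately have "psd (1 *\<^sub>R 1 - 2 *\<^sub>R (1 :: 'a))" by (rule psd_trans)
    then have "psd ((-1) *\<^sub>R (1 :: 'a))" by (simp add: scaleR_2)
    then show False by (simp only: psd_real_iff)
  qed
  then obtain k where k: "k \<ge> 1" "\<not> psd (a k - (2 / N) *\<^sub>R 1)" by auto
  obtain r where r: "isometry r" "psd ((2 / N) *\<^sub>R 1 - star r * a k * r)"
    using isometry_compression[OF simple_UNIV pi_UNIV psd_selfadj[OF a_psd] k(2)] by blast
  have small: "norm (star r * a k * r) \<le> 2 / N"
    using psd_conj[OF a_psd] r(2) by (rule norm_le_of_psd)
  define f where "f = d * t k"
  define g where "g = d * (t 0 * r)"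
  have g_eq: "g = e * r" by (simp add: g_def e_def mult.assoc)
  have f: "isometry f" and g: "isometry g"
    unfolding f_def g_def by (intro isometry_mult d t r)+
  have "star g * E (f * star f) * g = star r * a k * r"
    by (simp add: g_eq a_def f_def star_mult mult.assoc)
  then have gfg: "norm (star g * E (f * star f) * g) \<le> 2 / N" using small by simp
  have fg: "norm (star f * E (g * x)) \<le> \<mu> * norm x" for x
  proof (rule power2_le_imp_le)
    have "(norm (star f * E (g * x)))\<^sup>2 \<le> ind * norm (star g * E (f * star f) * g) * (norm x)\<^sup>2"
      using rank_one_bound[of "star f" g x] by (simp add: star_star)
    also have "\<dots> \<le> ind * (2 / N) * (norm x)\<^sup>2"
      using gfg index_pos by (intro mult_right_mono mult_left_mono) auto
    also have "\<dots> \<le> \<mu>\<^sup>2 * (norm x)\<^sup>2" using indN by (intro mult_right_mono) auto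
    finally show "(norm (star f * E (g * x)))\<^sup>2 \<le> (\<mu> * norm x)\<^sup>2" by (simp add: power_mult_distrib)
  qed (use \<mu> in auto)
  have "norm (star f * E (g * star g) * f) \<le> \<mu>"
    using norm_mult_isometry[OF f, of "star f * E (g * star g)"] fg[of "star g"]
    by (simp add: isometry_norm g)
  then have fgf: "ind * norm (star f * E (g * star g) * f) \<le> \<kappa>\<^sup>2"
    using \<mu>(3) index_pos by (meson mult_left_mono less_imp_le order_trans)
  have "decoupled \<kappa> f g"
    unfolding decoupled_def using fg \<mu>(2) by (meson mult_right_mono norm_ge_zero order_trans)
  moreover have "decoupled \<kappa> g f"
    unfolding decoupled_def
  proof (intro allI, rule power2_le_imp_le)
    fix x
    have "(norm (star g * E (f * x)))\<^sup>2 \<le> ind * norm (star f * E (g * star g) * f) * (norm x)\<^sup>2"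
      using rank_one_bound[of "star g" f x] by (simp add: star_star)
    also have "\<dots> \<le> \<kappa>\<^sup>2 * (norm x)\<^sup>2" using fgf by (intro mult_right_mono) auto
    finally show "(norm (star g * E (f * x)))\<^sup>2 \<le> (\<kappa> * norm x)\<^sup>2" by (simp add: power_mult_distrib)
  qed (use \<kappa> in auto)
  moreover have "star (t k) * (t 0 * r) = 0" using orth[of k 0] k by (simp flip: mult.assoc)
  moreover have "isometry (t 0 * r)" by (intro isometry_mult t r)
  ultimately show thesis unfolding f_def g_def using t that by blast
qed

lemma compress_mult: "compress (d * c) a = star c * compress d (c * a)"
  by (simp add: compress_def star_mult mult.assoc)

text \<open>
  Take \<open>d\<close> nearly minimizing the norm of its weight among all \<open>v c\<close>. By the parallelogram
  identity, all compressions by isometries of two decoupled restrictions of \<open>d\<close> are close to each other.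
\<close>

lemma compress_almost_invariant:
  assumes v: "isometry v" and \<eta>: "\<eta> > 0"
  obtains c where "isometry c"
    "\<And>u a. isometry u \<Longrightarrow> norm (compress (v * c * u) a - compress (v * c) a) \<le> \<eta> * norm a"
proof -
  \<comment> \<open>The parallelogram estimate will give \<open>4 * (\<delta> + \<epsilon>) + 12 *
    \<epsilon> - 4 * (\<delta> - \<epsilon>) = 20 * \<epsilon>\<close>, and \<open>ind\<close> times
    this is to be the square of \<open>\<eta> / 2\<close>.\<close>
  define \<epsilon> where "\<epsilon> = (\<eta> / 2)\<^sup>2 / (20 * ind)"
  have \<epsilon>: "\<epsilon> > 0" using \<eta> index_pos by (simp add: \<epsilon>_def)
  have ind\<epsilon>: "ind * (20 * \<epsilon>) = (\<eta> / 2)\<^sup>2" using index_pos by (simp add: \<epsilon>_def field_simps)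
  define W where "W = {norm (weight (v * c)) |c. isometry c}"
  have bdd: "bdd_below W" unfolding W_def by (rule bdd_belowI[of _ 0]) auto
  have ne: "W \<noteq> {}" unfolding W_def using isometry_one by blast
  define \<delta> where "\<delta> = Inf W"
  have \<delta>_le: "\<delta> \<le> norm (weight (v * c))" if "isometry c" for c
    unfolding \<delta>_def using that by (intro cInf_lower bdd) (auto simp: W_def)
  have "Inf W < \<delta> + \<epsilon>" using \<epsilon> by (simp add: \<delta>_def)
  then obtain w where "w \<in> W" "w < \<delta> + \<epsilon>" using cInf_lessD[OF ne] by blast
  then obtain c0 where c0: "isometry c0" "norm (weight (v * c0)) < \<delta> + \<epsilon>"
    by (auto simp: W_def)
  define d where "d = v * c0"
  have d: "isometry d" unfolding d_def by (intro isometry_mult v c0)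
  \<comment> \<open>Near-minimality of the norm improves to an operator lower bound: otherwise a
    further compression would push the weight below the infimum.\<close>
  have lower: "psd (weight (d * c) - (\<delta> - \<epsilon>) *\<^sub>R 1)" if c: "isometry c" for c
  proof (rule ccontr)
    assume "\<not> ?thesis"
    then obtain r where r: "isometry r" "psd ((\<delta> - \<epsilon>) *\<^sub>R 1 - star r * weight (d * c) * r)"
      using isometry_compression[OF simple_UNIV pi_UNIV psd_selfadj[OF weight_psd]] by blast
    have "psd ((\<delta> - \<epsilon>) *\<^sub>R 1 - weight (d * c * r))"
      by (rule psd_trans[OF weight_mult_psd[OF r(1)] r(2)])
    then have "norm (weight (d * c * r)) \<le> \<delta> - \<epsilon>" by (rule norm_le_of_psd[OF weight_psd])
    moreover have "\<delta> \<le> norm (weight (v * (c0 * c * r)))"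
      by (intro \<delta>_le isometry_mult c0 c r)
    ultimately show False using \<epsilon> by (simp add: d_def mult.assoc)
  qed
  from decoupled_exists[OF d \<epsilon>]
  obtain r q where rq: "isometry r" "isometry q" and orth: "star r * q = 0"
    and dec: "decoupled \<epsilon> (d * r) (d * q)" "decoupled \<epsilon> (d * q) (d * r)" by blast
  have orth': "star q * r = 0" using arg_cong[OF orth, of star] by (simp add: star_mult star_star)
  have close: "norm (compress (d * r * c) a - compress (d * q * c') a) \<le> (\<eta> / 2) * norm a"
    if c: "isometry c" "isometry c'" for c c' a
  proof -
    define f where "f = d * r * c"
    define g where "g = d * q * c'"
    \<comment> \<open>\<open>d * k\<close> is \<open>(f + g) / sqrt 2\<close>; orthogonality of the
      ranges of \<open>r\<close> and \<open>q\<close> makes \<open>k\<close> an isometry. Weights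
      are of degree four, hence the factor 1/4 below.\<close>
    define k where "k = (1 / sqrt 2) *\<^sub>R (r * c + q * c')"
    have "star (r * c + q * c') * (r * c + q * c') = star c * (star r * r) * c + star c * (star r * q) * c'
        + star c' * (star q * r) * c + star c' * (star q * q) * c'"
      by (simp add: star_add star_mult algebra_simps)
    also have "\<dots> = 2 *\<^sub>R 1"
      using c rq by (simp add: orth orth' isometryD scaleR_2)
    finally have k: "isometry k"
      by (simp add: isometry_def k_def star_scaleR)
    have "weight (d * k) = (1/4) *\<^sub>R weight (f + g)"
    proof -
      have "d * k = (1 / sqrt 2) *\<^sub>R (f + g)" by (simp add: k_def f_def g_def algebra_simps)
      then have "weight (d * k) = ((1 / sqrt 2) * (1 / sqrt 2) * ((1 / sqrt 2) * (1 / sqrt 2))) *\<^sub>R weight (f + g)"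
        unfolding weight_def by (simp add: star_scaleR E_scaleR mult_ac)
      also have "(1 / sqrt 2) * (1 / sqrt 2) * ((1 / sqrt 2) * (1 / sqrt 2)) = (1/4::real)" by simp
      finally show ?thesis .
    qed
    then have "weight (f + g) - (4 * (\<delta> - \<epsilon>)) *\<^sub>R 1 = 4 *\<^sub>R (weight (d * k) - (\<delta> - \<epsilon>) *\<^sub>R 1)"
      by (simp add: algebra_simps)
    then have fg: "psd (weight (f + g) - (4 * (\<delta> - \<epsilon>)) *\<^sub>R 1)"
      using psd_scaleR[OF lower[OF k], of 4] by simp
    have "norm (distance_weight f g) \<le> 4 * (\<delta> + \<epsilon>) + 12 * \<epsilon> - 4 * (\<delta> - \<epsilon>)"
    proof (rule distance_weight_bound[OF _ _ _ _ _ _ fg])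
      show "isometry f" "isometry g" unfolding f_def g_def by (intro isometry_mult d rq c)+
      show "decoupled \<epsilon> f g" "decoupled \<epsilon> g f"
        unfolding f_def g_def by (intro decoupled_mult dec c)+
      have "norm (weight (d * h)) \<le> \<delta> + \<epsilon>" if "isometry h" for h
        using weight_mult_norm_le[OF that, of d] c0(2) by (simp add: d_def)
      then show "norm (weight f) \<le> \<delta> + \<epsilon>" "norm (weight g) \<le> \<delta> + \<epsilon>"
        unfolding f_def g_def mult.assoc by (simp_all add: isometry_mult rq c)
    qed
    then have "ind * norm (distance_weight f g) \<le> ind * (20 * \<epsilon>)"
      using index_pos by (intro mult_left_mono) auto
    then have "ind * norm (distance_weight f g) * (norm a)\<^sup>2 \<le> ((\<eta> / 2) * norm a)\<^sup>2"
      unfolding ind\<epsilon> power_mult_distrib by (intro mult_right_mono) auto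
    with compress_diff_bound[of f a g] have "(norm (compress f a - compress g a))\<^sup>2 \<le> ((\<eta> / 2) * norm a)\<^sup>2"
      by linarith
    then have "norm (compress f a - compress g a) \<le> (\<eta> / 2) * norm a"
      by (rule power2_le_imp_le) (use \<eta> in auto)
    then show ?thesis by (simp add: f_def g_def)
  qed
  show thesis
  proof (rule that)
    show "isometry (c0 * r)" by (intro isometry_mult c0 rq)
    fix u a :: 'a assume u: "isometry u"
    \<comment> \<open>Both compressions are compared with that of \<open>d * q\<close>, which costs
      \<open>\<eta> / 2\<close> each time.\<close>
    have "compress (d * r * u) a - compress (d * r) a = (compress (d * r * u) a - compress (d * q * 1) a)
        - (compress (d * r * 1) a - compress (d * q * 1) a)" by simp
    then have "norm (compress (d * r * u) a - compress (d * r) a) \<le> (\<eta> / 2) * norm a + (\<eta> / 2) * norm a"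
      using norm_triangle_ineq4 close[OF u isometry_one, of a] close[OF isometry_one isometry_one, of a]
      by (smt (verit))
    then show "norm (compress (v * (c0 * r) * u) a - compress (v * (c0 * r)) a) \<le> \<eta> * norm a"
      by (simp add: d_def mult.assoc field_simps)
  qed
qed

section \<open>From almost invariance to almost scalar compressions\<close>

definition almost_invariant :: "real \<Rightarrow> 'a \<Rightarrow> bool" where
  "almost_invariant \<eta> d \<longleftrightarrow>
     (\<forall>u a. isometry u \<longrightarrow> norm (compress (d * u) a - compress d a) \<le> \<eta> * norm a)"

lemma compress_add: "compress d (a + b) = compress d a + compress d b"
  by (simp add: compress_def algebra_simps E_add)

lemma compress_scaleC: "compress d (c *\<^sub>C a) = c *\<^sub>C compress d a"
  by (simp add: compress_def mult_scaleC_right E_scaleC)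

lemma compress_scaleR: "compress d (r *\<^sub>R a) = r *\<^sub>R compress d a"
  by (simp add: compress_def E_scaleR)

lemma compress_right: "b \<in> B \<Longrightarrow> compress d (a * b) = compress d a * b"
  using E_right[of b "d * a"] by (simp add: compress_def mult.assoc)

text \<open>For unitary \<open>u\<close>, \<open>compress (d * u) 1 = star u * compress d u\<close>,
  so invariance at 1 is left linearity at \<open>u\<close>. Self-adjoint contractions are means of
  two unitaries, and the cartesian decomposition costs the factor 2.\<close>

lemma compress_almost_left_linear:
  assumes inv: "almost_invariant \<eta> d" and \<eta>: "\<eta> \<ge> 0"
  shows "norm (compress d a - a * compress d 1) \<le> 2 * \<eta> * norm a"
proof -
  define D where "D x = compress d x - x * compress d 1" for x
  have D_add: "D (x + y) = D x + D y" for x y by (simp add: D_def compress_add algebra_simps)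
  have D_scaleC: "D (c *\<^sub>C x) = c *\<^sub>C D x" for c x
    by (simp add: D_def compress_scaleC mult_scaleC_left scaleC_diff_right)
  have D_scaleR: "D (r *\<^sub>R x) = r *\<^sub>R D x" for r x
    by (simp add: D_def compress_scaleR scaleR_right_diff_distrib)
  have unitary: "norm (D u) \<le> \<eta>" if u: "star u * u = 1" "u * star u = 1" for u
  proof -
    have "isometry u" using u by (simp add: isometry_def)
    then have "norm (compress (d * u) 1 - compress d 1) \<le> \<eta>"
      using inv[unfolded almost_invariant_def, rule_format, of u 1] by simp
    moreover have "D u = u * (compress (d * u) 1 - compress d 1)"
      by (simp add: D_def compress_mult algebra_simps) (simp add: u(2) flip: mult.assoc)
    ultimately show ?thesis
      using norm_mult_ineq[of u "compress (d * u) 1 - compress d 1"] isometry_norm[OF \<open>isometry u\<close>] by simp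
  qed
  have sa1: "norm (D h) \<le> \<eta>" if h: "star h = h" "norm h \<le> 1" for h
  proof -
    obtain u where u: "star u * u = 1" "u * star u = 1" "2 *\<^sub>R h = u + star u"
      by (rule unitary_mean[OF h])
    have "norm (D u) \<le> \<eta>" "norm (D (star u)) \<le> \<eta>" using u by (auto intro: unitary simp: star_star)
    then have "norm (D (2 *\<^sub>R h)) \<le> \<eta> + \<eta>" unfolding u(3) D_add by (rule norm_triangle_mono)
    then show ?thesis by (simp add: D_scaleR)
  qed
  have sa: "norm (D h) \<le> \<eta> * norm h" if h: "star h = h" for h
  proof (cases "h = 0")
    case True
    then show ?thesis using D_scaleR[of 0 0] by simp
  next
    case False
    have "norm (D ((1 / norm h) *\<^sub>R h)) \<le> \<eta>"
      using False by (intro sa1) (simp_all add: star_scaleR h)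
    then show ?thesis using False by (simp add: D_scaleR field_simps)
  qed
  obtain h k where hk: "star h = h" "star k = k" "a = h + \<i> *\<^sub>C k" "norm h \<le> norm a" "norm k \<le> norm a"
    by (rule cartesian_decomposition)
  have "D a = D h + \<i> *\<^sub>C D k" by (simp add: hk(3) D_add D_scaleC)
  then have "norm (D a) \<le> norm (D h) + norm (D k)"
    using norm_triangle_ineq[of "D h" "\<i> *\<^sub>C D k"] by (simp add: norm_scaleC)
  also have "\<dots> \<le> \<eta> * norm h + \<eta> * norm k" by (intro add_mono sa hk)
  also have "\<dots> \<le> \<eta> * norm a + \<eta> * norm a" by (intro add_mono mult_left_mono hk \<eta>)
  finally show ?thesis by (simp add: D_def)
qed

text \<open>A nested sequence of restrictions makes the values at 1 converge, so that one
  \<open>\<tau>\<close> serves for every \<open>\<epsilon>\<close>.\<close>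

lemma compress_almost_scalar:
  assumes v: "isometry v"
  obtains \<tau> where "\<And>\<epsilon>. \<epsilon> > 0 \<Longrightarrow>
    \<exists>c. isometry c \<and> (\<forall>a. norm (compress (v * c) a - \<tau> *\<^sub>C a) \<le> \<epsilon> * norm a)"
proof -
  have ex: "\<exists>c. isometry c \<and> almost_invariant \<eta> (w * c)" if w: "isometry w" "\<eta> > 0" for w \<eta>
  proof -
    obtain c where "isometry c"
      "\<And>u a. isometry u \<Longrightarrow> norm (compress (w * c * u) a - compress (w * c) a) \<le> \<eta> * norm a"
      by (rule compress_almost_invariant[OF w]) (rule that)
    then show ?thesis unfolding almost_invariant_def by blast
  qed
  define P where "P n c \<longleftrightarrow> isometry c \<and> almost_invariant ((1/2) ^ n) (v * c)" for n :: nat and c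
  \<comment> \<open>Each choice restricts the previous one, so almost invariance at stage
    \<open>n\<close> controls all later stages.\<close>
  have "\<exists>s. \<forall>n. P n (s n) \<and> (\<exists>u. isometry u \<and> s (Suc n) = s n * u)"
  proof (rule dependent_nat_choice)
    show "\<exists>c. P 0 c" unfolding P_def using ex[OF v, of 1] by auto
    fix c n assume "P n c"
    then have c: "isometry c" by (simp add: P_def)
    obtain u where "isometry u" "almost_invariant ((1/2) ^ Suc n) (v * c * u)"
      using ex[OF isometry_mult[OF v c], of "(1/2) ^ Suc n"] by auto
    then show "\<exists>y. P (Suc n) y \<and> (\<exists>u. isometry u \<and> y = c * u)"
      unfolding P_def using c isometry_mult by (intro exI[of _ "c * u"]) (auto simp: mult.assoc)
  qed
  then obtain s where s: "\<And>n. isometry (s n)" "\<And>n. almost_invariant ((1/2) ^ n) (v * s n)"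
    and step: "\<And>n. \<exists>u. isometry u \<and> s (Suc n) = s n * u"
    unfolding P_def by blast
  have ext: "\<exists>u. isometry u \<and> s (n + k) = s n * u" for n k
  proof (induction k)
    case 0
    show ?case by (intro exI[of _ 1]) simp
  next
    case (Suc k)
    then obtain u u' where "isometry u" "s (n + k) = s n * u" "isometry u'" "s (n + Suc k) = s (n + k) * u'"
      using step[of "n + k"] by auto
    then show ?case by (intro exI[of _ "u * u'"]) (simp add: isometry_mult mult.assoc)
  qed
  have close: "norm (compress (v * s m) a - compress (v * s n) a) \<le> (1/2) ^ n * norm a" if nm: "n \<le> m" for m n a
  proof -
    obtain u where "isometry u" "s m = s n * u" using ext[of n "m - n"] nm by auto
    then show ?thesis using s(2)[of n] by (simp add: almost_invariant_def mult.assoc)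
  qed
  define \<theta> where "\<theta> n = compress (v * s n) 1" for n
  have half: "(\<lambda>n. (1/2::real) ^ n) \<longlonglongrightarrow> 0" by (rule LIMSEQ_realpow_zero) auto
  have "Cauchy \<theta>"
  proof (rule metric_CauchyI)
    fix e :: real assume "e > 0"
    then obtain N where N: "(1/2::real) ^ N < e / 2"
      using real_arch_pow_inv[of "e / 2" "1/2"] by auto
    have "dist (\<theta> m) (\<theta> n) < e" if "m \<ge> N" "n \<ge> N" for m n
    proof -
      have "dist (\<theta> k) (\<theta> N) \<le> (1/2) ^ N" if "k \<ge> N" for k
        using close[OF that, of 1] by (simp add: \<theta>_def dist_norm)
      from this[OF that(1)] this[OF that(2)] N show ?thesis
        using dist_triangle2[of "\<theta> m" "\<theta> n" "\<theta> N"] by linarith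
    qed
    then show "\<exists>M. \<forall>m\<ge>M. \<forall>n\<ge>M. dist (\<theta> m) (\<theta> n) < e" by blast
  qed
  then obtain \<theta>' where lim: "\<theta> \<longlonglongrightarrow> \<theta>'" using Cauchy_convergent convergent_def by blast
  have lin: "norm (compress (v * s n) a - a * \<theta> n) \<le> 2 * (1/2) ^ n * norm a" for n a
    unfolding \<theta>_def by (rule compress_almost_left_linear[OF s(2)]) simp
  \<comment> \<open>Right \<open>B\<close>-linearity gives
    \<open>compress (v * s n) b = \<theta> n * b\<close>, and almost left linearity compares this
    with \<open>b * \<theta> n\<close>.\<close>
  have "\<theta>' * b = b * \<theta>'" if b: "b \<in> B" for b
  proof -
    have "(\<lambda>n. \<theta> n * b - b * \<theta> n) \<longlonglongrightarrow> \<theta>' * b - b * \<theta>'" by (intro tendsto_intros lim)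
    moreover have "(\<lambda>n. \<theta> n * b - b * \<theta> n) \<longlonglongrightarrow> 0"
    proof (rule tendsto_norm_zero_cancel, rule tendsto_sandwich[OF _ _ tendsto_const])
      show "(\<lambda>n. 2 * (1/2) ^ n * norm b) \<longlonglongrightarrow> 0"
        using tendsto_mult[OF tendsto_mult[OF tendsto_const[of 2] half] tendsto_const[of "norm b"]]
        by simp
      show "\<forall>\<^sub>F n in sequentially. norm (\<theta> n * b - b * \<theta> n) \<le> 2 * (1/2) ^ n * norm b"
        using lin[of _ b] compress_right[OF b, of _ 1] by (simp add: \<theta>_def)
    qed simp
    ultimately have "\<theta>' * b - b * \<theta>' = 0" by (rule LIMSEQ_unique)
    then show ?thesis by simp
  qed
  then have "\<theta>' \<in> relative_commutant B" by (simp add: relative_commutant_def)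
  then obtain \<tau> where \<tau>: "\<theta>' = \<tau> *\<^sub>C 1" using irreducible by (auto simp: irreducible_inclusion_def)
  show thesis
  proof (rule that)
    fix \<epsilon> :: real assume \<epsilon>: "\<epsilon> > 0"
    have "\<forall>\<^sub>F n in sequentially. dist (\<theta> n) \<theta>' < \<epsilon> / 2" using lim \<epsilon> by (intro tendstoD) auto
    moreover have "\<forall>\<^sub>F n in sequentially. (1/2::real) ^ n < \<epsilon> / 4"
      using half \<epsilon> by (intro order_tendstoD) auto
    ultimately have "\<forall>\<^sub>F n in sequentially. dist (\<theta> n) \<theta>' < \<epsilon> / 2 \<and> (1/2::real) ^ n < \<epsilon> / 4"
      by (rule eventually_conj)
    then obtain n where n: "dist (\<theta> n) \<theta>' < \<epsilon> / 2" "(1/2::real) ^ n < \<epsilon> / 4"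
      using eventually_happens'[OF sequentially_bot] by blast
    have "norm (compress (v * s n) a - \<tau> *\<^sub>C a) \<le> \<epsilon> * norm a" for a
    proof -
      have "norm (a * (\<theta> n - \<theta>')) \<le> norm a * (\<epsilon> / 2)"
        using n(1) by (intro order_trans[OF norm_mult_ineq] mult_left_mono) (auto simp: dist_norm)
      moreover have "norm (compress (v * s n) a - a * \<theta> n) \<le> \<epsilon> / 2 * norm a"
        using n(2) by (intro order_trans[OF lin] mult_right_mono) auto
      moreover have "compress (v * s n) a - \<tau> *\<^sub>C a = (compress (v * s n) a - a * \<theta> n) + a * (\<theta> n - \<theta>')"
        by (simp add: \<tau> algebra_simps mult_scaleC_right)
      ultimately have "norm (compress (v * s n) a - \<tau> *\<^sub>C a) \<le> \<epsilon> / 2 * norm a + norm a * (\<epsilon> / 2)"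
        by (simp only:) (rule norm_triangle_mono)
      then show ?thesis by (simp add: field_simps)
    qed
    then show "\<exists>c. isometry c \<and> (\<forall>a. norm (compress (v * c) a - \<tau> *\<^sub>C a) \<le> \<epsilon> * norm a)"
      using s(1) by blast
  qed
qed

section \<open>Norming elements of \<open>B\<close>\<close>

lemma almost_unit_isometry:
  fixes x :: 'a
  assumes x: "x \<noteq> 0" and \<epsilon>: "\<epsilon> > 0"
  obtains v where "isometry v" "norm ((1 - (1 / (norm x)\<^sup>2) *\<^sub>R (star x * x)) * v) \<le> \<epsilon>"
proof -
  define X where "X = (1 / (norm x)\<^sup>2) *\<^sub>R (star x * x)"
  have X: "psd X" unfolding X_def by (intro psd_scaleR psd_star_mult) simp
  have nX: "norm X = 1" using x by (simp add: X_def cstar_identity)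
  have c: "psd (1 - X)" using psd_norm_minus[OF psd_selfadj[OF X], of 1] nX by simp
  \<comment> \<open>As \<open>norm X = 1\<close>, \<open>1 - X\<close> is not bounded below by any
    positive scalar. The square appears because the compression controls \<open>h * v\<close> for a
    root \<open>h\<close> of \<open>1 - X\<close>.\<close>
  have "\<not> psd (1 - X - \<epsilon>\<^sup>2 *\<^sub>R 1)"
  proof
    assume "psd (1 - X - \<epsilon>\<^sup>2 *\<^sub>R 1)"
    then have "psd ((1 - \<epsilon>\<^sup>2) *\<^sub>R 1 - X)" by (simp add: algebra_simps)
    then have "norm X \<le> 1 - \<epsilon>\<^sup>2" by (rule norm_le_of_psd[OF X])
    then show False using nX \<epsilon> by simp
  qed
  then obtain v where v: "isometry v" "psd (\<epsilon>\<^sup>2 *\<^sub>R 1 - star v * (1 - X) * v)"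
    using isometry_compression[OF simple_UNIV pi_UNIV psd_selfadj[OF c]] by blast
  obtain h where h: "star h = h" "1 - X = h * h" using c by (auto simp: psd_def)
  have "norm (1 - X) \<le> 1" using X by (intro norm_le_of_psd c) simp
  then have "(norm h)\<^sup>2 \<le> 1" using cstar_identity[of h] h by simp
  then have nh: "norm h \<le> 1" by (simp add: power2_le_iff_abs_le abs_square_le_1)
  have "star (h * v) * (h * v) = star v * (1 - X) * v" by (simp add: h star_mult mult.assoc)
  then have "(norm (h * v))\<^sup>2 \<le> \<epsilon>\<^sup>2"
    using norm_le_of_psd[OF psd_conj[OF c] v(2)] by (simp flip: cstar_identity)
  then have nhv: "norm (h * v) \<le> \<epsilon>" by (rule power2_le_imp_le) (use \<epsilon> in simp)
  have "norm ((1 - X) * v) \<le> norm h * norm (h * v)"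
    unfolding h(2) using norm_mult_ineq[of h "h * v"] by (simp add: mult.assoc)
  also have "\<dots> \<le> 1 * \<epsilon>" using nh nhv by (intro mult_mono) auto
  finally show thesis using that v(1) by (simp add: X_def)
qed

text \<open>Conjugating the finite index inequality for \<open>d * star d\<close> by
  \<open>d\<close> gives the bound, which keeps the limiting scalars away from 0.\<close>

lemma weight_lower: "isometry d \<Longrightarrow> inverse ind \<le> norm (weight d)"
proof -
  assume d: "isometry d"
  have "psd (E (d * star d) - inverse ind *\<^sub>R (d * star d))"
    using index_psd[OF psd_star_mult[of "star d"]] by (simp add: star_star)
  then have "psd (star d * (E (d * star d) - inverse ind *\<^sub>R (d * star d)) * d)" by (rule psd_conj)
  also have "star d * (E (d * star d) - inverse ind *\<^sub>R (d * star d)) * d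
      = weight d - inverse ind *\<^sub>R 1"
    using d by (simp add: weight_def algebra_simps isometryD isometryD')
  finally have "norm (inverse ind *\<^sub>R (1::'a)) \<le> norm (weight d)"
    using index_pos by (intro norm_mono_psd) (simp_all only: psd_real_iff, simp)
  then show ?thesis using index_pos by simp
qed

text \<open>For almost scalar \<open>f = v * c\<close> and \<open>g = w * c'\<close>,
  \<open>star f * E (f * star g) * g\<close> is close to \<open>\<tau>\<close>, while the norm of
  \<open>E (f * star g)\<close> is nearly at most \<open>cmod \<tau>\<close>. Normalizing
  \<open>E (f * star g)\<close> therefore yields \<open>b\<close>.\<close>

lemma almost_isometric_compression:
  assumes v: "isometry v" "isometry w" and \<mu>: "\<mu> > 0"
  obtains c c' b where "isometry c" "isometry c'" "b \<in> B" "norm b \<le> 1"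
    "1 - \<mu> \<le> norm (star (v * c) * b * (w * c'))"
proof -
  obtain \<tau> where \<tau>: "\<And>\<delta>. \<delta> > 0 \<Longrightarrow>
      \<exists>c. isometry c \<and> (\<forall>a. norm (compress (v * c) a - \<tau> *\<^sub>C a) \<le> \<delta> * norm a)"
    by (rule compress_almost_scalar[OF v(1)]) (rule that)
  obtain \<sigma> where \<sigma>: "\<And>\<delta>. \<delta> > 0 \<Longrightarrow>
      \<exists>c. isometry c \<and> (\<forall>a. norm (compress (w * c) a - \<sigma> *\<^sub>C a) \<le> \<delta> * norm a)"
    by (rule compress_almost_scalar[OF v(2)]) (rule that)
  define t where "t = cmod \<tau>"
  have scalar: "\<bar>norm (star f * E (f * star g) * g) - cmod \<rho>\<bar> \<le> \<delta>"
    if fg: "isometry f" "isometry g" and app: "\<And>a. norm (compress f a - \<rho> *\<^sub>C a) \<le> \<delta> * norm a"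
    for f g \<rho> \<delta>
  proof -
    have "star f * E (f * star g) * g - \<rho> *\<^sub>C 1 = (compress f (star g) - \<rho> *\<^sub>C star g) * g"
      using fg by (simp add: compress_def algebra_simps mult_scaleC_left isometryD)
    then have "norm (star f * E (f * star g) * g - \<rho> *\<^sub>C 1) \<le> norm (compress f (star g) - \<rho> *\<^sub>C star g)"
      using norm_mult_isometry[OF fg(2)] by simp
    also have "\<dots> \<le> \<delta>" using app[of "star g"] fg by (simp add: isometry_norm)
    finally have "norm (star f * E (f * star g) * g - \<rho> *\<^sub>C 1) \<le> \<delta>" .
    moreover have "norm (\<rho> *\<^sub>C (1::'a)) = cmod \<rho>" by (simp add: norm_scaleC)
    ultimately show ?thesis
      using norm_triangle_ineq3[of "star f * E (f * star g) * g" "\<rho> *\<^sub>C 1"] by linarith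
  qed
  have approx: "\<exists>c c'. isometry c \<and> isometry c' \<and> \<bar>t - cmod \<sigma>\<bar> \<le> 2 * \<delta> \<and> inverse ind \<le> t + \<delta> \<and>
      t - \<delta> \<le> norm (star (v * c) * E (v * c * star (w * c')) * (w * c')) \<and>
      (norm (E (v * c * star (w * c'))))\<^sup>2 \<le> cmod \<sigma> * (t + ind * \<delta>) + \<delta>"
    if \<delta>: "\<delta> > 0" for \<delta>
  proof -
    obtain c where c: "isometry c" "\<And>a. norm (compress (v * c) a - \<tau> *\<^sub>C a) \<le> \<delta> * norm a"
      using \<tau>[OF \<delta>] by blast
    obtain c' where c': "isometry c'" "\<And>a. norm (compress (w * c') a - \<sigma> *\<^sub>C a) \<le> \<delta> * norm a"
      using \<sigma>[OF \<delta>] by blast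
    define f where "f = v * c"
    define g where "g = w * c'"
    have f: "isometry f" and g: "isometry g" unfolding f_def g_def by (intro isometry_mult v c c')+
    note cf = c(2)[folded f_def] and cg = c'(2)[folded g_def]
    have k1: "\<bar>norm (star f * E (f * star g) * g) - t\<bar> \<le> \<delta>"
      unfolding t_def by (rule scalar[OF f g cf])
    have k2: "\<bar>norm (star g * E (g * star f) * f) - cmod \<sigma>\<bar> \<le> \<delta>" by (rule scalar[OF g f cg])
    have "star (star f * E (f * star g) * g) = star g * E (g * star f) * f"
      by (simp add: star_mult star_star mult.assoc flip: E_star)
    then have "norm (star f * E (f * star g) * g) = norm (star g * E (g * star f) * f)"
      using norm_star by metis
    with k1 k2 have t\<sigma>: "\<bar>t - cmod \<sigma>\<bar> \<le> 2 * \<delta>" by linarith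
    have k3: "\<bar>norm (weight f) - t\<bar> \<le> \<delta>"
      unfolding t_def weight_def by (rule scalar[OF f f cf])
    then have tind: "inverse ind \<le> t + \<delta>" using weight_lower[OF f] by linarith
    have prod: "norm (E (f * compress h (star f))) \<le> cmod \<rho> * norm (E (f * star f)) + \<delta>"
      if app: "\<And>a. norm (compress h a - \<rho> *\<^sub>C a) \<le> \<delta> * norm a" for h \<rho>
    proof -
      have "norm (E (f * (compress h (star f) - \<rho> *\<^sub>C star f))) \<le> norm (f * (compress h (star f) - \<rho> *\<^sub>C star f))"
        by (rule E_norm)
      also have "\<dots> \<le> norm (compress h (star f) - \<rho> *\<^sub>C star f)"
        using norm_mult_ineq[of f] f by (simp add: isometry_norm)
      also have "\<dots> \<le> \<delta>" using app[of "star f"] f by (simp add: isometry_norm)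
      finally have "norm (E (f * (compress h (star f) - \<rho> *\<^sub>C star f))) \<le> \<delta>" .
      moreover have "E (f * compress h (star f)) =
          \<rho> *\<^sub>C E (f * star f) + E (f * (compress h (star f) - \<rho> *\<^sub>C star f))"
        by (simp add: algebra_simps E_diff mult_scaleC_right E_scaleC)
      ultimately show ?thesis
        using norm_triangle_ineq[of "\<rho> *\<^sub>C E (f * star f)" "E (f * (compress h (star f) - \<rho> *\<^sub>C star f))"]
        by (simp add: norm_scaleC)
    qed
    define e where "e = norm (E (f * star f))"
    \<comment> \<open>By the bimodule property, \<open>E (f * star h)\<close> times its adjoint is
      \<open>E (f * compress h (star f))\<close>; almost scalarity reduces this to
      \<open>E (f * star f)\<close>.\<close>
    have square: "(norm (E (f * star h)))\<^sup>2 = norm (E (f * compress h (star f)))" for h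
    proof -
      have "E (f * star h) * star (E (f * star h)) = E (f * compress h (star f))"
        by (simp add: compress_def star_mult star_star E_mem E_right mult.assoc[symmetric] flip: E_star)
      then show ?thesis by (simp flip: cstar_identity')
    qed
    have e0: "inverse ind \<le> e"
      using weight_lower[OF f] weight_norm_le[OF f] by (simp add: e_def)
    moreover have "inverse ind > 0" using index_pos by simp
    ultimately have epos: "e > 0" by linarith
    have "e\<^sup>2 \<le> t * e + \<delta>"
      using square[of f] prod[OF cf] by (simp add: e_def t_def)
    \<comment> \<open>The lower bound \<open>inverse ind \<le> e\<close> makes the error
      proportional to \<open>e\<close>, so that \<open>e\<close> can be cancelled.\<close>
    also have "\<delta> \<le> ind * \<delta> * e"
      using e0 index_pos \<delta> by (simp add: field_simps)
    finally have "e * e \<le> (t + ind * \<delta>) * e" by (simp add: power2_eq_square algebra_simps)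
    then have e_le: "e \<le> t + ind * \<delta>" using epos by simp
    have "(norm (E (f * star g)))\<^sup>2 \<le> cmod \<sigma> * e + \<delta>"
      using square[of g] prod[OF cg] by (simp add: e_def)
    also have "\<dots> \<le> cmod \<sigma> * (t + ind * \<delta>) + \<delta>" using e_le by (simp add: mult_left_mono)
    finally have "(norm (E (f * star g)))\<^sup>2 \<le> cmod \<sigma> * (t + ind * \<delta>) + \<delta>" .
    moreover have "t - \<delta> \<le> norm (star f * E (f * star g) * g)" using k1 by linarith
    ultimately show ?thesis
      using c(1) c'(1) t\<sigma> tind unfolding f_def g_def by blast
  qed
  \<comment> \<open>\<open>\<tau>\<close> and \<open>\<sigma>\<close> do not depend on
    \<open>\<delta>\<close>, so their approximate relations become exact.\<close>
  have "\<bar>t - cmod \<sigma>\<bar> \<le> 0 + \<delta>" if "\<delta> > 0" for \<delta>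
    using approx[of "\<delta> / 2"] that by auto
  then have "\<bar>t - cmod \<sigma>\<bar> \<le> 0" by (rule field_le_epsilon)
  then have \<sigma>t: "cmod \<sigma> = t" by simp
  have "inverse ind \<le> t + \<delta>" if "\<delta> > 0" for \<delta>
    using approx[OF that] by auto
  then have "inverse ind \<le> t" by (rule field_le_epsilon)
  moreover have "inverse ind > 0" using index_pos by simp
  ultimately have t: "t > 0" by linarith
  \<comment> \<open>This quotient bounds the compressed norm of the normalized element from below,
    and its limit is \<open>t / sqrt (t * t) = 1\<close>.\<close>
  have "((\<lambda>\<delta>. (t - \<delta>) / sqrt (t * (t + ind * \<delta>) + \<delta>)) \<longlongrightarrow> (t - 0) / sqrt (t * (t + ind * 0) + 0)) (at_right 0)"
    using t by (intro tendsto_intros) auto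
  then have "((\<lambda>\<delta>. (t - \<delta>) / sqrt (t * (t + ind * \<delta>) + \<delta>)) \<longlongrightarrow> 1) (at_right 0)"
    using t by simp
  then have "\<forall>\<^sub>F \<delta> in at_right 0. 1 - \<mu> < (t - \<delta>) / sqrt (t * (t + ind * \<delta>) + \<delta>)"
    using \<mu> by (intro order_tendstoD) auto
  then have "\<forall>\<^sub>F \<delta> in at_right (0::real). 1 - \<mu> < (t - \<delta>) / sqrt (t * (t + ind * \<delta>) + \<delta>) \<and> 0 < \<delta>"
    using eventually_at_right_less by (rule eventually_conj)
  then obtain \<delta> where \<delta>: "1 - \<mu> < (t - \<delta>) / sqrt (t * (t + ind * \<delta>) + \<delta>)" "0 < \<delta>"
    using eventually_happens'[OF trivial_limit_at_right_real] by blast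
  define \<beta> where "\<beta> = sqrt (t * (t + ind * \<delta>) + \<delta>)"
  have \<beta>: "\<beta> > 0" unfolding \<beta>_def using t index_pos \<delta> by (intro real_sqrt_gt_zero add_pos_pos mult_pos_pos) auto
  obtain c c' where c: "isometry c" "isometry c'"
    and low: "t - \<delta> \<le> norm (star (v * c) * E (v * c * star (w * c')) * (w * c'))"
    and up: "(norm (E (v * c * star (w * c'))))\<^sup>2 \<le> t * (t + ind * \<delta>) + \<delta>"
    using approx[OF \<delta>(2)] unfolding \<sigma>t by blast
  define b where "b = (1 / \<beta>) *\<^sub>R E (v * c * star (w * c'))"
  show thesis
  proof (rule that[OF c])
    show "b \<in> B"
      unfolding b_def scaleC_of_real[symmetric] using subalg E_mem by (simp add: cstar_subalgebra_def)
    have "norm (E (v * c * star (w * c'))) \<le> \<beta>" unfolding \<beta>_def using up by (rule real_le_rsqrt)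
    then show "norm b \<le> 1" using \<beta> by (simp add: b_def)
    have "1 - \<mu> \<le> (t - \<delta>) / \<beta>" using \<delta>(1) by (simp add: \<beta>_def)
    also have "\<dots> \<le> norm (star (v * c) * E (v * c * star (w * c')) * (w * c')) / \<beta>"
      using low \<beta> by (simp add: divide_right_mono)
    also have "\<dots> = norm (star (v * c) * b * (w * c'))" using \<beta> by (simp add: b_def)
    finally show "1 - \<mu> \<le> norm (star (v * c) * b * (w * c'))" .
  qed
qed

text \<open>Inserting \<open>X\<close> next to \<open>star f\<close> and \<open>Y\<close> next to
  \<open>g\<close> costs \<open>\<epsilon>\<close> each, and the compression a third
  \<open>\<epsilon>\<close>. The product \<open>X * b * Y\<close> contains the factor
  \<open>x * b * y\<close>, whose norm is thereby bounded below.\<close>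

lemma almost_norming:
  assumes x: "x \<noteq> 0" and y: "y \<noteq> 0" and \<epsilon>: "\<epsilon> > 0"
  obtains b where "b \<in> B" "norm b \<le> 1" "(1 - 3 * \<epsilon>) * (norm x * norm y) \<le> norm (x * b * y)"
proof -
  define X where "X = (1 / (norm x)\<^sup>2) *\<^sub>R (star x * x)"
  define Y where "Y = (1 / (norm y)\<^sup>2) *\<^sub>R (y * star y)"
  obtain v where v: "isometry v" "norm ((1 - X) * v) \<le> \<epsilon>"
    unfolding X_def by (rule almost_unit_isometry[OF x \<epsilon>])
  have "star y \<noteq> 0" using y by (metis norm_eq_zero norm_star)
  then obtain w where w: "isometry w" "norm ((1 - Y) * w) \<le> \<epsilon>"
    using almost_unit_isometry[of "star y", OF _ \<epsilon>] unfolding Y_def by (auto simp: star_star)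
  obtain c c' b where c: "isometry c" "isometry c'" and b: "b \<in> B" "norm b \<le> 1"
    and low: "1 - \<epsilon> \<le> norm (star (v * c) * b * (w * c'))"
    by (rule almost_isometric_compression[OF v(1) w(1) \<epsilon>]) (rule that)
  define f where "f = v * c"
  define g where "g = w * c'"
  have f: "isometry f" and g: "isometry g" unfolding f_def g_def by (intro isometry_mult v w c)+
  have Xf: "norm ((1 - X) * f) \<le> \<epsilon>"
    using norm_mult_isometry[OF c(1), of "(1 - X) * v"] v(2) by (simp add: f_def mult.assoc)
  have Yg: "norm ((1 - Y) * g) \<le> \<epsilon>"
    using norm_mult_isometry[OF c(2), of "(1 - Y) * w"] w(2) by (simp add: g_def mult.assoc)
  have sX: "star (1 - X) = 1 - X" by (simp add: X_def star_diff star_scaleR star_mult star_star)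
  have fX: "norm (star f * (1 - X)) \<le> \<epsilon>"
    using Xf norm_star[of "(1 - X) * f"] by (simp only: star_mult sX)
  have nX: "norm X = 1" using x by (simp add: X_def cstar_identity)
  have bg: "norm (b * g) \<le> 1" using norm_mult_isometry[OF g, of b] b by linarith
  have "norm (star f * (1 - X) * (b * g)) \<le> \<epsilon> * 1"
    by (rule order_trans[OF norm_mult_ineq mult_mono[OF fX bg]]) (use \<epsilon> in auto)
  moreover have "norm (star f * X * b * ((1 - Y) * g)) \<le> 1 * \<epsilon>"
  proof -
    have "norm (star f * X * b) \<le> norm (star f * X) * norm b" by (rule norm_mult_ineq)
    also have "\<dots> \<le> 1 * 1"
      using norm_star_isometry_mult[OF f, of X] nX b by (intro mult_mono) auto
    finally have "norm (star f * X * b) \<le> 1" by simp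
    from mult_mono[OF this Yg] show ?thesis by (intro order_trans[OF norm_mult_ineq]) auto
  qed
  moreover have dec: "star f * b * g = star f * X * b * Y * g + star f * (1 - X) * (b * g)
      + star f * X * b * ((1 - Y) * g)"
    by (simp add: algebra_simps)
  ultimately have main: "1 - 3 * \<epsilon> \<le> norm (star f * X * b * Y * g)"
    using low[folded f_def g_def, unfolded dec] norm_triangle_ineq[of "star f * X * b * Y * g + star f * (1 - X) * (b * g)"
        "star f * X * b * ((1 - Y) * g)"]
      norm_triangle_ineq[of "star f * X * b * Y * g" "star f * (1 - X) * (b * g)"] by linarith
  have "star f * X * b * Y * g =
      (1 / ((norm x)\<^sup>2 * (norm y)\<^sup>2)) *\<^sub>R (star f * (star x * (x * b * y) * star y) * g)"
    by (simp add: X_def Y_def mult.assoc)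
  then have "norm (star f * X * b * Y * g) =
      norm (star f * (star x * (x * b * y) * star y) * g) / ((norm x)\<^sup>2 * (norm y)\<^sup>2)" by simp
  also have "\<dots> \<le> (norm x * norm (x * b * y) * norm y) / ((norm x)\<^sup>2 * (norm y)\<^sup>2)"
  proof (rule divide_right_mono)
    have "norm (star f * (star x * (x * b * y) * star y) * g) \<le> norm (star x * (x * b * y) * star y)"
      using norm_mult_isometry[OF g] norm_star_isometry_mult[OF f] order_trans by blast
    also have "\<dots> \<le> norm (star x * (x * b * y)) * norm y"
      using norm_mult_ineq[of "star x * (x * b * y)" "star y"] by simp
    also have "\<dots> \<le> norm x * norm (x * b * y) * norm y"
      using norm_mult_ineq[of "star x" "x * b * y"] by (intro mult_right_mono) auto
    finally show "norm (star f * (star x * (x * b * y) * star y) * g) \<le> norm x * norm (x * b * y) * norm y" .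
  qed simp
  also have "\<dots> = norm (x * b * y) / (norm x * norm y)"
    using x y by (simp add: power2_eq_square field_simps)
  finally have "1 - 3 * \<epsilon> \<le> norm (x * b * y) / (norm x * norm y)" using main by linarith
  then have "(1 - 3 * \<epsilon>) * (norm x * norm y) \<le> norm (x * b * y)"
    using x y by (simp add: le_divide_eq)
  with b show thesis by (rule that)
qed

lemma BEK: "property_BEK B"
  unfolding property_BEK_def
proof (intro allI)
  fix x y :: 'a
  let ?S = "{b \<in> B. norm b \<le> 1}"
  have upper: "norm (x * b * y) \<le> norm x * norm y" if "b \<in> ?S" for b
  proof -
    have "norm (x * b * y) \<le> norm x * norm b * norm y"
      using norm_mult_ineq[of "x * b" y] norm_mult_ineq[of x b]
      by (meson mult_right_mono norm_ge_zero order_trans)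
    also have "\<dots> \<le> norm x * 1 * norm y"
      using that by (intro mult_right_mono mult_left_mono) auto
    finally show ?thesis by simp
  qed
  have bdd: "bdd_above ((\<lambda>b. norm (x * b * y)) ` ?S)"
    using upper by (intro bdd_aboveI2[where M = "norm x * norm y"]) auto
  have ne: "?S \<noteq> {}" using subalg by (auto simp: cstar_subalgebra_def intro!: exI[of _ 0])
  show "(SUP b\<in>?S. norm (x * b * y)) = norm x * norm y"
  proof (rule antisym)
    show "(SUP b\<in>?S. norm (x * b * y)) \<le> norm x * norm y" using ne upper by (rule cSUP_least)
    show "norm x * norm y \<le> (SUP b\<in>?S. norm (x * b * y))"
    proof (cases "x = 0 \<or> y = 0")
      case True
      have "0 \<in> ?S" using subalg by (simp add: cstar_subalgebra_def)
      then show ?thesis using cSUP_upper[OF _ bdd, of 0] True by auto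
    next
      case False
      show ?thesis
      proof (rule field_le_epsilon)
        fix e :: real assume e: "e > 0"
        \<comment> \<open>Scaled so that the loss \<open>3 * \<epsilon> * (norm x * norm y)\<close>
          equals \<open>e\<close>.\<close>
        define \<epsilon> where "\<epsilon> = e / (3 * (norm x * norm y))"
        have "\<epsilon> > 0" using False e by (simp add: \<epsilon>_def)
        then obtain b where b: "b \<in> B" "norm b \<le> 1"
            "(1 - 3 * \<epsilon>) * (norm x * norm y) \<le> norm (x * b * y)"
          using almost_norming[of x y \<epsilon>] False by blast
        have "3 * \<epsilon> * (norm x * norm y) = e" using False by (simp add: \<epsilon>_def)
        then have "norm x * norm y - e \<le> norm (x * b * y)"
          using b(3) by (simp add: left_diff_distrib)
        also have "\<dots> \<le> (SUP b\<in>?S. norm (x * b * y))"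
          using b by (intro cSUP_upper bdd) auto
        finally show "norm x * norm y \<le> (SUP b\<in>?S. norm (x * b * y)) + e" by simp
      qed
    qed
  qed
qed

end

text \<open>The unit of \<open>B\<close> commutes with \<open>B\<close> and is thus a scalar; a
  nonzero idempotent scalar is 1.\<close>

lemma irreducible_unit_mem:
  fixes B :: "'a::unital_cstar_algebra set"
  assumes "unital_on B" "simple_cstar B" "irreducible_inclusion B"
  shows "1 \<in> B"
proof -
  obtain e where e: "e \<in> B" "\<And>b. b \<in> B \<Longrightarrow> e * b = b \<and> b * e = b"
    using assms(1) by (auto simp: unital_on_def)
  have "e \<in> relative_commutant B" using e by (simp add: relative_commutant_def)
  then obtain c where c: "e = c *\<^sub>C 1"
    using assms(3) by (auto simp: irreducible_inclusion_def)
  have "e \<noteq> 0"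
  proof
    assume "e = 0"
    then have "B = {0}" using e by auto
    then show False using assms(2) by (simp add: simple_cstar_def)
  qed
  then have "c \<noteq> 0" using c scaleC_of_real[of 0 "1::'a"] by auto
  have "e * e = e" using e by blast
  then have "(c * c) *\<^sub>C (1::'a) = c *\<^sub>C 1" by (simp add: c mult_scaleC_left scaleC_scaleC)
  then have "(c * c - c) *\<^sub>C (1::'a) = 0"
    using scaleC_add_left[of "c * c - c" c "1::'a"] by simp
  then have "cmod (c * c - c) = 0" using norm_scaleC[of "c * c - c" "1::'a"] by simp
  then have "c = 1" using \<open>c \<noteq> 0\<close> by simp
  then show ?thesis using e c by simp
qed

theorem theorem3p1:
  fixes B :: "'a::unital_cstar_algebra set"
    and E :: "'a \<Rightarrow> 'a"
  assumes "cstar_subalgebra B" and "unital_on B"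
    and "separable_space (top_of_set (UNIV :: 'a set))"
    and "separable_space (top_of_set B)"
    and "simple_cstar (UNIV :: 'a set)" and "purely_infinite (UNIV :: 'a set)"
    and "simple_cstar B" and "purely_infinite B"
    and "irreducible_inclusion B"
    and "conditional_expectation B E" and "finite_index E"
  shows "property_BEK B"
proof -
  obtain ind :: real where "ind \<ge> 1" "positive_map (\<lambda>x. E x - inverse ind *\<^sub>R x)"
    using assms(11) by (auto simp: finite_index_def)
  then interpret finite_index_expectation B E ind
    using assms irreducible_unit_mem[of B] by unfold_locales auto
  show ?thesis by (rule BEK)
qed

end
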